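(* Let $L$ be a bounded, self-adjoint, non-negative linear operator on $\mathcal{H}_{\mathrm u}$, and let $C:\mathcal{H}_{\mathrm r}\to\mathcal{H}_{\mathrm u}$ be a bounded linear operator. Define $$K_L(t):=C^*e^{-tL}C,\qquad t\ge0 .$$ Let $T>0$. For $x\in L^2(0,T;\mathcal{H}_{\mathrm r})$ set $$q(t):=\int_0^te^{-(t-s)L}Cx(s)\,ds .$$ Then $q\in H^1(0,T;\mathcal{H}_{\mathrm u})$, $$\frac{d}{dt}q+Lq=Cx,\qquad q(0)=0,$$ and $$\int_0^T\big((K_L*x)(t),x(t)\big)\,dt=\frac12\|q(T)\|_{\mathcal{H}_{\mathrm u}}^2+\int_0^T\|L^{1/2}q(t)\|_{\mathcal{H}_{\mathrm u}}^2\,dt\ \ge0 .$$ Therefore, $K_L$ is of positive type on any finite time interval.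
   Context: $\mathcal{H}_{\mathrm r}$ and $\mathcal{H}_{\mathrm u}$ are separable real Hilbert spaces with inner products denoted $(\cdot,\cdot)$. For an operator-valued kernel $K$ on $[0,\infty)$ with values in the bounded operators on $\mathcal{H}_{\mathrm r}$, $(K*x)(t):=\int_0^tK(t-s)x(s)\,ds$. A kernel $K$ is of positive type on $[0,T]$ if $\int_0^T((K*x)(t),x(t))\,dt\ge0$ for every $x\in L^2(0,T;\mathcal{H}_{\mathrm r})$. *)

theory Defs
  imports "HOL-Analysis.Analysis"
begin

text \<open>
  A separable real Hilbert space is a type of class
  \<open>{real_inner, banach, second_countable_topology}\<close>, and bounded linear operators are
  elements of the type \<open>'a \<Rightarrow>\<^sub>L 'b\<close>.
\<close>

section \<open>Operators on Hilbert spaces\<close>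

text \<open>
  On a Hilbert space the library's \<open>adjoint\<close> of a bounded operator exists and is again bounded
  (Riesz representation), so \<open>Blinfun\<close> is applied here to a bounded linear map.
\<close>

definition blinfun_adjoint ::
    "('a::{real_inner, banach} \<Rightarrow>\<^sub>L 'b::{real_inner, banach}) \<Rightarrow> 'b \<Rightarrow>\<^sub>L 'a" where
  "blinfun_adjoint A = Blinfun (adjoint (blinfun_apply A))"

definition self_adjoint :: "('a::real_inner \<Rightarrow>\<^sub>L 'a) \<Rightarrow> bool" where
  "self_adjoint A \<longleftrightarrow> (\<forall>x y. inner (A x) y = inner x (A y))"

definition nonneg_op :: "('a::real_inner \<Rightarrow>\<^sub>L 'a) \<Rightarrow> bool" where
  "nonneg_op A \<longleftrightarrow> (\<forall>x. 0 \<le> inner (A x) x)"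

text \<open>
  The library's \<open>exp\<close> requires the class \<open>real_normed_algebra_1\<close>, of which the operator type is
  not an instance; this is the same power series, convergent in operator norm.
\<close>

definition op_exp :: "('a::banach \<Rightarrow>\<^sub>L 'a) \<Rightarrow> 'a \<Rightarrow>\<^sub>L 'a" where
  "op_exp A = (\<Sum>n. (1 / fact n) *\<^sub>R (((o\<^sub>L) A ^^ n) id_blinfun))"

text \<open>
  A bounded self-adjoint non-negative operator has exactly one self-adjoint non-negative square
  root, so the choice is not arbitrary.
\<close>

definition op_sqrt :: "('a::{real_inner, banach} \<Rightarrow>\<^sub>L 'a) \<Rightarrow> 'a \<Rightarrow>\<^sub>L 'a" where
  "op_sqrt A = (SOME S. self_adjoint S \<and> nonneg_op S \<and> S o\<^sub>L S = A)"


section \<open>Function spaces on a bounded interval\<close>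

text \<open>
  Integrals are Bochner integrals with respect to Lebesgue measure. Elements of the spaces are
  represented by functions on the whole line, of which only the values on \<open>[0, T]\<close> matter.
\<close>

definition in_L2 ::
    "real \<Rightarrow> (real \<Rightarrow> 'a::{real_inner, banach, second_countable_topology}) \<Rightarrow> bool" where
  "in_L2 T u \<longleftrightarrow>
     set_borel_measurable lebesgue {0..T} u \<and> set_integrable lebesgue {0..T} (\<lambda>t. (norm (u t))\<^sup>2)"

definition test_function :: "real \<Rightarrow> (real \<Rightarrow> real) \<Rightarrow> bool" where
  "test_function T \<phi> \<longleftrightarrow>
     (\<forall>n t. (deriv ^^ n) \<phi> differentiable (at t)) \<and>
     compact (closure {t. \<phi> t \<noteq> 0}) \<and> closure {t. \<phi> t \<noteq> 0} \<subseteq> {0<..<T}"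

definition has_weak_deriv ::
    "real \<Rightarrow> (real \<Rightarrow> 'a::{real_inner, banach, second_countable_topology}) \<Rightarrow> (real \<Rightarrow> 'a) \<Rightarrow> bool"
where
  "has_weak_deriv T u v \<longleftrightarrow>
     set_integrable lebesgue {0..T} u \<and> set_integrable lebesgue {0..T} v \<and>
     (\<forall>\<phi>. test_function T \<phi> \<longrightarrow>
        (LINT t:{0..T}|lebesgue. deriv \<phi> t *\<^sub>R u t) = - (LINT t:{0..T}|lebesgue. \<phi> t *\<^sub>R v t))"

definition in_H1 ::
    "real \<Rightarrow> (real \<Rightarrow> 'a::{real_inner, banach, second_countable_topology}) \<Rightarrow> bool" where
  "in_H1 T u \<longleftrightarrow> in_L2 T u \<and> (\<exists>v. in_L2 T v \<and> has_weak_deriv T u v)"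


section \<open>Operator-valued kernels\<close>

definition kernel_conv ::
    "(real \<Rightarrow> 'a::{real_inner, banach, second_countable_topology} \<Rightarrow>\<^sub>L 'a) \<Rightarrow> (real \<Rightarrow> 'a) \<Rightarrow> real \<Rightarrow> 'a"
where
  "kernel_conv K x t = (LINT s:{0..t}|lebesgue. K (t - s) (x s))"

text \<open>
  The integrability clauses say that the quadratic form is well defined. Without them the
  convention that a non-integrable function has integral \<open>0\<close> would admit spurious kernels.
\<close>

definition positive_type_on ::
    "real \<Rightarrow> (real \<Rightarrow> 'a::{real_inner, banach, second_countable_topology} \<Rightarrow>\<^sub>L 'a) \<Rightarrow> bool" where
  "positive_type_on T K \<longleftrightarrow>
     (\<forall>x. in_L2 T x \<longrightarrow>
        (AE t in lebesgue. t \<in> {0..T} \<longrightarrow> set_integrable lebesgue {0..t} (\<lambda>s. K (t - s) (x s))) \<and>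
        set_integrable lebesgue {0..T} (\<lambda>t. inner (kernel_conv K x t) (x t)) \<and>
        0 \<le> (LINT t:{0..T}|lebesgue. inner (kernel_conv K x t) (x t)))"

definition semigroup_kernel ::
    "('u::{real_inner, banach} \<Rightarrow>\<^sub>L 'u) \<Rightarrow> ('r::{real_inner, banach} \<Rightarrow>\<^sub>L 'u) \<Rightarrow> real \<Rightarrow> 'r \<Rightarrow>\<^sub>L 'r"
where
  "semigroup_kernel L C t = blinfun_adjoint C o\<^sub>L op_exp ((- t) *\<^sub>R L) o\<^sub>L C"

end

theory Submission
  imports Defs
begin

text \<open>
  With \<open>f = C x\<close> and \<open>p(t) = \<integral>\<^sub>0\<^sup>t e\<^bsup>sL\<^esup> f(s) ds\<close>
  one has \<open>q(t) = e\<^bsup>-tL\<^esup> p(t)\<close>. Integrating by parts turns this into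
  \<open>q(t) = \<integral>\<^sub>0\<^sup>t (f - L q)\<close>, and two further integrations by parts on the
  integral equation give the weak derivative \<open>q' = f - L q\<close> and
  \<open>\<parallel>q(T)\<parallel>\<^sup>2 = 2 \<integral>\<^sub>0\<^sup>T (q', q)\<close>. Since
  \<open>K\<^sub>L * x = C\<^sup>* q\<close>, the quadratic form is \<open>\<integral>\<^sub>0\<^sup>T (q, f)\<close>, and
  \<open>(L q, q) = \<parallel>L\<^bsup>1/2\<^esup> q\<parallel>\<^sup>2\<close> finishes the energy identity. Integration
  by parts for Bochner integrals is Fubini's theorem on a triangle.
\<close>

section \<open>Riesz representation and adjoints\<close>

text \<open>As \<open>x\<close> is only square integrable, \<open>C x\<close> may be discontinuous
  and \<open>q\<close> need not be differentiable at every point. So no product rule is applied to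
  \<open>q\<close>; the integral equation, valid at every t, carries the argument. A single
  integration by parts, for a bounded bilinear product of two integrable functions, is used three
  times: with \<open>inner\<close> and the orbit of a test vector, with \<open>scaleR\<close> and a
  test function, and with \<open>inner\<close> and q' paired with itself. Boundedness of
  \<open>L\<close> makes the exponential a norm-continuous group, so that e^(-(t-s)L) splits into
  e^(-tL) e^(sL). The adjoint and the square root are given by choice, so existence has to come
  first: the adjoint is found by minimizing a quadratic functional, the root by the binomial series
  of sqrt (1 - z), whose coefficients are absolutely summable, so that it converges up to |z| =
  1.\<close>

lemma minimizer_of_quadratic_functional:
  fixes f :: "'a::{real_inner, banach} \<Rightarrow> real"
  assumes f: "bounded_linear f"
  shows "\<exists>z. \<forall>x. (norm z)\<^sup>2 - 2 * f z \<le> (norm x)\<^sup>2 - 2 * f x"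
proof -
  interpret f: bounded_linear f by fact
  define J where "J x = (norm x)\<^sup>2 - 2 * f x" for x
  obtain K where K: "\<And>x. norm (f x) \<le> norm x * K"
    using f.bounded by blast
  have "- K\<^sup>2 \<le> J x" for x
  proof -
    have "0 \<le> (norm x - K)\<^sup>2" by simp
    then show ?thesis using K[of x] by (simp add: J_def power2_diff)
  qed
  then have bdd: "bdd_below (range J)" by (intro bdd_belowI[of _ "- K\<^sup>2"]) auto
  define m where "m = Inf (range J)"
  have m_le: "m \<le> J x" for x unfolding m_def by (intro cInf_lower bdd) auto
  have "\<exists>x. J x < m + 1 / real (Suc n)" for n
    using cInf_lessD[of "range J" "m + 1 / real (Suc n)"] by (auto simp: m_def)
  then obtain X where X: "\<And>n. J (X n) < m + 1 / real (Suc n)" by metis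
  \<comment> \<open>Parallelogram law: the linear parts of \<open>J\<close> cancel, and
    \<open>J\<close> at the midpoint is at least \<open>m\<close>. Hence two excesses over
    \<open>m\<close> below e^2 / 4 put the points within distance e.\<close>
  have par: "(norm (x - y))\<^sup>2 \<le> 2 * (J x - m) + 2 * (J y - m)" for x y
  proof -
    have "(norm (x - y))\<^sup>2 = 2 * J x + 2 * J y - 4 * J ((1/2) *\<^sub>R (x + y))"
      using inner_commute[of x y]
      by (simp add: J_def f.add f.scaleR power2_norm_eq_inner inner_diff inner_add algebra_simps
          del: norm_scaleR)
    then show ?thesis using m_le[of "(1/2) *\<^sub>R (x + y)"] by simp
  qed
  have "Cauchy X"
  proof (rule metric_CauchyI)
    fix e :: real assume e: "0 < e"
    then obtain N where N: "1 / real (Suc N) < e\<^sup>2 / 4"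
      by (metis nat_approx_posE divide_pos_pos zero_less_numeral zero_less_power)
    have "dist (X k) (X n) < e" if "k \<ge> N" "n \<ge> N" for k n
    proof -
      have less: "J (X i) - m < e\<^sup>2 / 4" if "i \<ge> N" for i
      proof -
        have "1 / real (Suc i) \<le> 1 / real (Suc N)" using that by (simp add: frac_le)
        then show ?thesis using X[of i] N by linarith
      qed
      have "(norm (X k - X n))\<^sup>2 < e\<^sup>2"
        using par[of "X k" "X n"] less[OF that(1)] less[OF that(2)] by (simp add: field_simps)
      then show ?thesis using e by (simp add: dist_norm power2_less_imp_less)
    qed
    then show "\<exists>M. \<forall>m\<ge>M. \<forall>n\<ge>M. dist (X m) (X n) < e" by blast
  qed
  then obtain z where z: "X \<longlonglongrightarrow> z" using Cauchy_convergent convergentD by blast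
  have "(\<lambda>n. J (X n)) \<longlonglongrightarrow> J z"
    unfolding J_def by (intro tendsto_intros f.tendsto z)
  moreover have "(\<lambda>n. m + 1 / real (Suc n)) \<longlonglongrightarrow> m + 0"
    by (intro tendsto_intros LIMSEQ_Suc lim_1_over_n)
  ultimately have "J z \<le> m + 0"
    by (rule LIMSEQ_le) (use X less_imp_le in blast)
  then have "J z \<le> J x" for x using m_le[of x] by simp
  then show ?thesis unfolding J_def by blast
qed

lemma riesz_representation:
  fixes f :: "'a::{real_inner, banach} \<Rightarrow> real"
  assumes f: "bounded_linear f"
  obtains z where "\<And>x. f x = inner x z"
proof -
  interpret f: bounded_linear f by fact
  obtain z where z: "\<And>x. (norm z)\<^sup>2 - 2 * f z \<le> (norm x)\<^sup>2 - 2 * f x"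
    using minimizer_of_quadratic_functional[OF f] by blast
  have "f v = inner v z" for v
  proof (rule ccontr)
    define d where "d = f v - inner v z"
    assume "f v \<noteq> inner v z"
    then have d: "d \<noteq> 0" and "v \<noteq> 0" by (auto simp: d_def f.zero)
    then have v: "inner v v > 0" by simp
    \<comment> \<open>\<open>t\<close> minimizes t^2 (v, v) - 2 t d, the change of the functional
      from \<open>z\<close> to \<open>z + t *\<^sub>R v\<close>; the minimum - d^2 / (v, v) would be
      negative.\<close>
    define t where "t = d / inner v v"
    have "(norm z)\<^sup>2 - 2 * f z \<le> (norm (z + t *\<^sub>R v))\<^sup>2 - 2 * f (z + t *\<^sub>R v)" by (rule z)
    then have "0 \<le> t * t * inner v v - 2 * t * d"
      by (simp add: d_def f.add f.scaleR power2_norm_eq_inner inner_add inner_commute algebra_simps)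
    also have "\<dots> = - (d * d) / inner v v"
      using v by (simp add: t_def field_simps)
    also have "\<dots> < 0" using d v by (intro divide_neg_pos) (auto simp: zero_less_mult_iff)
    finally show False by simp
  qed
  then show ?thesis using that by blast
qed

text \<open>\<open>adjoint\<close> is a choice, and \<open>Blinfun\<close> is meaningful only on
  bounded linear maps. Riesz supplies the map, testing with inner products makes it linear, and ||A*
  y||^2 = (A A* y, y) bounds its norm by that of \<open>A\<close>.\<close>

lemma inner_blinfun_adjoint:
  fixes A :: "'a::{real_inner, banach} \<Rightarrow>\<^sub>L 'b::{real_inner, banach}"
  shows "inner (blinfun_adjoint A y) x = inner y (A x)"
proof -
  have "\<exists>z. \<forall>x. inner (A x) y = inner x z" for y
    by (rule riesz_representation[OF bounded_linear_compose[OF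
          bounded_linear_inner_left[of y] blinfun.bounded_linear_right[of A]]]) blast
  then have "\<exists>f'. \<forall>x y. inner (A x) y = inner x (f' y)" by metis
  then have adj: "inner (A x) y = inner x (adjoint A y)" for x y
    unfolding adjoint_def using someI_ex[of "\<lambda>f'. \<forall>x y. inner (A x) y = inner x (f' y)"] by blast
  have "bounded_linear (adjoint A)"
  proof (rule bounded_linear_intro[where K = "norm A"])
    show "adjoint A (x + y) = adjoint A x + adjoint A y" for x y
      by (subst vector_eq_ldot[symmetric]) (simp add: inner_add_right flip: adj)
    show "adjoint A (r *\<^sub>R x) = r *\<^sub>R adjoint A x" for r x
      by (subst vector_eq_ldot[symmetric]) (simp flip: adj)
    show "norm (adjoint A y) \<le> norm y * norm A" for y
    proof -
      let ?z = "adjoint A y"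
      have "norm ?z * norm ?z = inner (A ?z) y"
        by (simp add: adj flip: power2_norm_eq_inner power2_eq_square)
      also have "\<dots> \<le> norm (A ?z) * norm y" by (rule norm_cauchy_schwarz)
      also have "\<dots> \<le> (norm A * norm ?z) * norm y"
        by (intro mult_right_mono norm_blinfun) auto
      finally have "norm ?z * norm ?z \<le> norm ?z * (norm y * norm A)" by (simp add: mult_ac)
      then show ?thesis by (cases "?z = 0") (auto simp: mult_le_cancel_left)
    qed
  qed
  then show ?thesis
    unfolding blinfun_adjoint_def
    by (simp add: bounded_linear_Blinfun_apply inner_commute flip: adj)
qed


section \<open>Power series in an operator\<close>

abbreviation op_pow :: "('a::real_normed_vector \<Rightarrow>\<^sub>L 'a) \<Rightarrow> nat \<Rightarrow> 'a \<Rightarrow>\<^sub>L 'a" where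
  "op_pow A n \<equiv> ((o\<^sub>L) A ^^ n) id_blinfun"

lemma op_pow_add: "op_pow A (m + n) = op_pow A m o\<^sub>L op_pow A n"
proof (induction m)
  case 0 show ?case by (rule blinfun_eqI) simp
next
  case (Suc m)
  then show ?case by (intro blinfun_eqI) simp
qed

lemma op_pow_scaleR: "op_pow (t *\<^sub>R A) n = t ^ n *\<^sub>R op_pow A n"
proof (induction n)
  case (Suc n)
  then show ?case by (intro blinfun_eqI) (simp add: blinfun.scaleR_left blinfun.scaleR_right)
qed simp

lemma norm_op_pow: "norm (op_pow A n) \<le> norm A ^ n"
proof (induction n)
  case (Suc n)
  have "norm (op_pow A (Suc n)) \<le> norm A * norm (op_pow A n)"
    by (simp add: norm_blinfun_compose)
  also have "\<dots> \<le> norm A * norm A ^ n" using Suc by (intro mult_left_mono) auto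
  finally show ?case by simp
qed (simp add: norm_blinfun_id_le)

lemma self_adjoint_op_pow:
  assumes "self_adjoint A"
  shows "self_adjoint (op_pow A n)"
proof (induction n)
  case 0
  show ?case by (simp add: self_adjoint_def)
next
  case (Suc n)
  have "A (op_pow A n y) = op_pow A n (A y)" for y
    by (induction n arbitrary: y) simp_all
  then show ?case using assms Suc by (simp add: self_adjoint_def)
qed

text \<open>The exponential and the root of 1 - B are both of this form, so self-adjointness and
  products are proved once, for coefficients absolutely summable against the powers of
  \<open>norm A\<close>.\<close>

definition op_series :: "(nat \<Rightarrow> real) \<Rightarrow> ('a::banach \<Rightarrow>\<^sub>L 'a) \<Rightarrow> 'a \<Rightarrow>\<^sub>L 'a" where
  "op_series a A = (\<Sum>n. a n *\<^sub>R op_pow A n)"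

abbreviation op_abs_summable :: "(nat \<Rightarrow> real) \<Rightarrow> ('a::real_normed_vector \<Rightarrow>\<^sub>L 'a) \<Rightarrow> bool" where
  "op_abs_summable a A \<equiv> summable (\<lambda>n. \<bar>a n\<bar> * norm A ^ n)"

lemma norm_op_series_term: "norm (a n *\<^sub>R op_pow A n) \<le> \<bar>a n\<bar> * norm A ^ n"
  by (simp add: mult_left_mono norm_op_pow)

lemma summable_norm_op_series:
  assumes "op_abs_summable a A"
  shows "summable (\<lambda>n. norm (a n *\<^sub>R op_pow A n))"
  by (rule summable_comparison_test'[OF assms]) (simp add: norm_op_series_term del: norm_scaleR)

lemma op_series_sums:
  assumes "op_abs_summable a A"
  shows "(\<lambda>n. a n *\<^sub>R op_pow A n) sums op_series a A"
  unfolding op_series_def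
  by (rule summable_sums[OF summable_norm_cancel[OF summable_norm_op_series[OF assms]]])

lemma self_adjoint_op_series:
  assumes A: "self_adjoint A" and a: "op_abs_summable a A"
  shows "self_adjoint (op_series a A)"
  unfolding self_adjoint_def
proof (intro allI)
  fix x y
  have "(\<lambda>n. inner ((a n *\<^sub>R op_pow A n) x) y) sums inner (op_series a A x) y"
    by (intro bounded_linear.sums[OF bounded_linear_inner_left]
        bounded_linear.sums[OF blinfun.bounded_linear_left] op_series_sums a)
  moreover have "(\<lambda>n. inner x ((a n *\<^sub>R op_pow A n) y)) sums inner x (op_series a A y)"
    by (intro bounded_linear.sums[OF bounded_linear_inner_right]
        bounded_linear.sums[OF blinfun.bounded_linear_left] op_series_sums a)
  moreover have "inner ((a n *\<^sub>R op_pow A n) x) y = inner x ((a n *\<^sub>R op_pow A n) y)" for n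
    using self_adjoint_op_pow[OF A, of n] by (simp add: self_adjoint_def blinfun.scaleR_left)
  ultimately show "inner (op_series a A x) y = inner x (op_series a A y)"
    using sums_unique2 by auto
qed

text \<open>The family of all products of terms is absolutely summable over pairs of indices. Summed
  by rows it gives the composition, summed along the diagonals i + j = n the convolution.\<close>

lemma op_series_mult:
  assumes a: "op_abs_summable a A" and b: "op_abs_summable b A"
  shows "op_series a A o\<^sub>L op_series b A = op_series (\<lambda>n. \<Sum>i\<le>n. a i * b (n - i)) A"
proof -
  define \<phi> where "\<phi> = (\<lambda>(i, j). (a i * b j) *\<^sub>R op_pow A (i + j))"
  have \<phi>: "\<phi> (i, j) = (a i *\<^sub>R op_pow A i) o\<^sub>L (b j *\<^sub>R op_pow A j)" for i j
    by (simp add: \<phi>_def op_pow_add) (auto intro!: blinfun_eqI simp: blinfun.bilinear_simps)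
  have hs: "((\<lambda>n. c n *\<^sub>R op_pow A n) has_sum op_series c A) UNIV"
    if "op_abs_summable c A" for c
    by (rule norm_summable_imp_has_sum[OF summable_norm_op_series[OF that] op_series_sums[OF that]])
  have abs: "(\<lambda>n. \<bar>c n\<bar> * norm A ^ n) summable_on UNIV" if "op_abs_summable c A" for c
    by (rule norm_summable_imp_summable_on) (use that in \<open>simp add: abs_mult\<close>)
  have "(\<lambda>(i, j). (\<bar>a i\<bar> * norm A ^ i) * (\<bar>b j\<bar> * norm A ^ j))
      summable_on UNIV \<times> UNIV"
    by (rule summable_on_SigmaI[where g = "\<lambda>i. (\<bar>a i\<bar> * norm A ^ i) * (\<Sum>\<^sub>\<infinity>j. \<bar>b j\<bar> * norm A ^ j)"])
      (auto intro!: has_sum_cmult_right has_sum_infsum abs summable_on_cmult_left a b)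
  moreover have "norm (\<phi> p) \<le> (case p of (i, j) \<Rightarrow> (\<bar>a i\<bar> * norm A ^ i) * (\<bar>b j\<bar> * norm A ^ j))" for p
  proof (cases p)
    case (Pair i j)
    have "norm (\<phi> (i, j)) \<le> norm (a i *\<^sub>R op_pow A i) * norm (b j *\<^sub>R op_pow A j)"
      unfolding \<phi> by (rule norm_blinfun_compose)
    also have "\<dots> \<le> (\<bar>a i\<bar> * norm A ^ i) * (\<bar>b j\<bar> * norm A ^ j)"
      by (intro mult_mono norm_op_series_term) auto
    finally show ?thesis by (simp add: Pair)
  qed
  ultimately have "(\<lambda>p. norm (\<phi> p)) summable_on UNIV \<times> UNIV"
    by (rule Infinite_Sum.abs_summable_on_comparison_test')
  then have "\<phi> summable_on UNIV \<times> UNIV" by (rule abs_summable_summable)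
  then obtain S where S: "(\<phi> has_sum S) (UNIV \<times> UNIV)" by (auto simp: summable_on_def)
  have "((\<lambda>i. (a i *\<^sub>R op_pow A i) o\<^sub>L op_series b A) has_sum S) UNIV"
    by (rule has_sum_Sigma[OF isUCont_plus S])
      (auto simp: \<phi> intro!: has_sum_bounded_linear[OF
        bounded_bilinear.bounded_linear_right[OF bounded_bilinear_blinfun_compose], unfolded o_def] hs b)
  moreover have "((\<lambda>i. (a i *\<^sub>R op_pow A i) o\<^sub>L op_series b A) has_sum (op_series a A o\<^sub>L op_series b A)) UNIV"
    by (intro has_sum_bounded_linear[OF
        bounded_bilinear.bounded_linear_left[OF bounded_bilinear_blinfun_compose], unfolded o_def] hs a)
  ultimately have S1: "S = op_series a A o\<^sub>L op_series b A"
    using has_sum_unique by blast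
  have "((\<lambda>(n, i). \<phi> (i, n - i)) has_sum S) (Sigma UNIV (\<lambda>n. {..n}))"
    by (subst has_sum_reindex_bij_witness[of _ "\<lambda>(i, j). (i + j, i)" "\<lambda>(n, i). (i, n - i)" "UNIV \<times> UNIV" \<phi>])
      (use S in auto)
  then have "((\<lambda>n. \<Sum>i\<le>n. \<phi> (i, n - i)) has_sum S) UNIV"
    by (rule has_sum_Sigma[OF isUCont_plus]) (auto intro!: has_sum_finiteI)
  then have "(\<lambda>n. \<Sum>i\<le>n. \<phi> (i, n - i)) sums S" by (rule has_sum_imp_sums)
  also have "(\<lambda>n. \<Sum>i\<le>n. \<phi> (i, n - i)) = (\<lambda>n. (\<Sum>i\<le>n. a i * b (n - i)) *\<^sub>R op_pow A n)"
    by (auto simp: \<phi>_def scaleR_sum_left)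
  finally show ?thesis by (simp add: S1 op_series_def sums_unique)
qed


section \<open>Square roots of non-negative operators\<close>

text \<open>Taylor coefficients of \<open>sqrt (1 - z)\<close> at \<open>0\<close>, and their partial sums.\<close>

definition sqrt_coeff :: "nat \<Rightarrow> real" where
  "sqrt_coeff n = (- 1) ^ n * (1 / 2 gchoose n)"

definition sqrt_coeff_psum :: "nat \<Rightarrow> real" where
  "sqrt_coeff_psum n = (- 1) ^ n * (- (1 / 2) gchoose n)"

text \<open>Taking partial sums of coefficients is division by 1 - z, and sqrt (1 - z) / (1 - z) =
  (1 - z)^(-1/2).\<close>

lemma sum_sqrt_coeff: "(\<Sum>k\<le>n. sqrt_coeff k) = sqrt_coeff_psum n"
  using gbinomial_sum_lower_neg[of "1 / 2 :: real" n]
  by (simp add: sqrt_coeff_def sqrt_coeff_psum_def mult.commute)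

lemma sqrt_coeff_psum_Suc:
  "sqrt_coeff_psum (Suc n) = (real n + 1 / 2) / (real n + 1) * sqrt_coeff_psum n"
proof -
  let ?g = "\<lambda>k. - (1 / 2 :: real) gchoose k"
  have "(real n + 1) * ?g (Suc n) = - (real n + 1 / 2) * ?g n"
    using gbinomial_mult_1[of "- (1 / 2 :: real)" n] by (simp add: algebra_simps)
  then have "?g (Suc n) = - ((real n + 1 / 2) / (real n + 1) * ?g n)"
    by (simp add: divide_simps) (simp add: algebra_simps)
  then show ?thesis by (simp add: sqrt_coeff_psum_def)
qed

lemma sqrt_coeff_psum_nonneg: "0 \<le> sqrt_coeff_psum n"
  by (induction n) (auto simp: sqrt_coeff_psum_Suc, simp add: sqrt_coeff_psum_def)

lemma sqrt_coeff_0: "sqrt_coeff 0 = 1"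
  by (simp add: sqrt_coeff_def)

lemma sqrt_coeff_Suc: "sqrt_coeff (Suc n) = sqrt_coeff_psum (Suc n) - sqrt_coeff_psum n"
  by (simp flip: sum_sqrt_coeff)

text \<open>The partial sums decrease, their successive ratio being (n + 1/2) / (n + 1) < 1.\<close>

lemma sqrt_coeff_Suc_nonpos: "sqrt_coeff (Suc n) \<le> 0"
proof -
  have "sqrt_coeff_psum (Suc n) \<le> 1 * sqrt_coeff_psum n"
    unfolding sqrt_coeff_psum_Suc by (intro mult_right_mono sqrt_coeff_psum_nonneg) simp
  then show ?thesis by (simp add: sqrt_coeff_Suc)
qed

text \<open>The coefficient at 0 is 1 and all others are nonpositive, so the sum of absolute values
  telescopes to 1 + (1 - \<open>sqrt_coeff_psum m\<close>), which is at most 2.\<close>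

lemma summable_abs_sqrt_coeff: "summable (\<lambda>n. \<bar>sqrt_coeff n\<bar>)"
proof (rule summableI_nonneg_bounded)
  fix n
  have "(\<Sum>k\<le>m. \<bar>sqrt_coeff k\<bar>) = 2 - sqrt_coeff_psum m" for m
  proof (induction m)
    case 0
    show ?case by (simp add: sqrt_coeff_0 sqrt_coeff_psum_def)
  next
    case (Suc m)
    then show ?case
      using sqrt_coeff_Suc_nonpos[of m] by (simp add: abs_of_nonpos sqrt_coeff_Suc)
  qed
  moreover have "(\<Sum>k<n. \<bar>sqrt_coeff k\<bar>) \<le> (\<Sum>k\<le>n. \<bar>sqrt_coeff k\<bar>)"
    by (rule sum_mono2) auto
  ultimately show "(\<Sum>k<n. \<bar>sqrt_coeff k\<bar>) \<le> 2"
    using sqrt_coeff_psum_nonneg[of n] by simp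
qed auto

text \<open>This is the value of sqrt (1 - z) at z = 1. The lower bound makes the constructed root
  non-negative.\<close>

lemma suminf_sqrt_coeff_nonneg: "0 \<le> suminf sqrt_coeff"
proof -
  have "(\<lambda>n. \<Sum>k\<le>n. sqrt_coeff k) \<longlonglongrightarrow> suminf sqrt_coeff"
    using summable_rabs_cancel[OF summable_abs_sqrt_coeff] summable_LIMSEQ' by blast
  then show ?thesis
    by (rule LIMSEQ_le_const) (simp add: sum_sqrt_coeff sqrt_coeff_psum_nonneg)
qed

text \<open>Vandermonde with 1/2 + 1/2 = 1: the square of the series is 1 - z.\<close>

lemma sqrt_coeff_convolution:
  "(\<Sum>i\<le>n. sqrt_coeff i * sqrt_coeff (n - i)) = (- 1) ^ n * real (1 choose n)"
proof -
  have "(\<Sum>i\<le>n. sqrt_coeff i * sqrt_coeff (n - i)) =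
      (\<Sum>i\<le>n. (- 1) ^ n * ((1 / 2 gchoose i) * (1 / 2 gchoose (n - i))))"
    by (intro sum.cong) (auto simp: sqrt_coeff_def mult_ac simp flip: power_add)
  also have "\<dots> = (- 1) ^ n * (1 / 2 + 1 / 2 gchoose n)"
    unfolding gbinomial_Vandermonde[symmetric] atMost_atLeast0 sum_distrib_left ..
  finally show ?thesis by (simp add: binomial_gbinomial)
qed

text \<open>The series needs an operator norm, while positivity only bounds quadratic forms. The
  bridge is B^2 <= B: it gives ||B x||^2 <= (B x, x) <= ||B x|| ||x||.\<close>

lemma norm_le_1_if_between_0_and_id:
  fixes B :: "'a::real_inner \<Rightarrow>\<^sub>L 'a"
  assumes sa: "self_adjoint B" and nn: "nonneg_op B" and le: "nonneg_op (id_blinfun - B)"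
  shows "norm B \<le> 1"
proof (rule norm_blinfun_bound)
  fix x
  let ?y = "B x"
  \<comment> \<open>\<open>B - B\<^sup>2 = (1 - B) B (1 - B) + B (1 - B) B\<close> is non-negative.\<close>
  have "0 \<le> inner (B (x - ?y)) (x - ?y) + inner ((id_blinfun - B) ?y) ?y"
    using nn le by (simp add: nonneg_op_def)
  also have "\<dots> = inner ?y x - inner (B ?y) x"
    by (simp add: blinfun.bilinear_simps inner_diff)
  also have "inner (B ?y) x = (norm ?y)\<^sup>2"
    using sa by (simp add: self_adjoint_def power2_norm_eq_inner)
  finally have "norm ?y * norm ?y \<le> norm ?y * norm x"
    using norm_cauchy_schwarz[of ?y x] by (simp add: power2_eq_square)
  then show "norm (B x) \<le> 1 * norm x"
    by (cases "?y = 0") (auto simp: mult_le_cancel_left)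
qed simp

text \<open>
  After scaling, \<open>A = 1 - B\<close> with \<open>0 \<le> B \<le> 1\<close>, and the Taylor series of \<open>sqrt (1 - z)\<close>
  converges absolutely at \<open>B\<close>.
\<close>

lemma nonneg_op_sqrt_exists:
  fixes A :: "'a::{real_inner, banach} \<Rightarrow>\<^sub>L 'a"
  assumes sa: "self_adjoint A" and nn: "nonneg_op A"
  shows "\<exists>S. self_adjoint S \<and> nonneg_op S \<and> S o\<^sub>L S = A"
proof -
  \<comment> \<open>B >= 0 requires \<open>k\<close> to dominate \<open>norm A\<close>; the summand
    1 keeps \<open>k\<close> positive when A = 0.\<close>
  define k where "k = norm A + 1"
  have k: "0 < k" by (simp add: k_def add_nonneg_pos)
  define B where "B = id_blinfun - (1 / k) *\<^sub>R A"
  have B_app: "B x = x - (1 / k) *\<^sub>R A x" for x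
    by (simp add: B_def blinfun.bilinear_simps)
  have saB: "self_adjoint B"
    using sa by (simp add: self_adjoint_def B_app inner_diff)
  have nnB: "nonneg_op B"
    unfolding nonneg_op_def
  proof
    fix x
    have "inner (A x) x \<le> norm (A x) * norm x" by (rule norm_cauchy_schwarz)
    also have "\<dots> \<le> (norm A * norm x) * norm x" by (intro mult_right_mono norm_blinfun) auto
    also have "\<dots> \<le> k * (norm x)\<^sup>2" by (simp add: k_def power2_eq_square algebra_simps)
    finally show "0 \<le> inner (B x) x"
      using k by (simp add: B_app inner_diff power2_norm_eq_inner field_simps)
  qed
  have "nonneg_op (id_blinfun - B)"
    using nn k by (simp add: nonneg_op_def B_def blinfun.bilinear_simps)
  with saB nnB have normB: "norm B \<le> 1" by (rule norm_le_1_if_between_0_and_id)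
  have summ: "op_abs_summable sqrt_coeff B"
  proof (rule summable_comparison_test'[OF summable_abs_sqrt_coeff])
    show "norm (\<bar>sqrt_coeff n\<bar> * norm B ^ n) \<le> \<bar>sqrt_coeff n\<bar>" for n
      using normB by (simp add: abs_mult mult_left_le power_le_one)
  qed
  define S where "S = op_series sqrt_coeff B"
  have saS: "self_adjoint S" unfolding S_def by (rule self_adjoint_op_series[OF saB summ])
  have nnS: "nonneg_op S"
    unfolding nonneg_op_def
  proof
    fix x
    have sums1: "(\<lambda>n. inner ((sqrt_coeff n *\<^sub>R op_pow B n) x) x) sums inner (S x) x"
      unfolding S_def
      by (intro bounded_linear.sums[OF bounded_linear_inner_left]
        bounded_linear.sums[OF blinfun.bounded_linear_left] op_series_sums summ)
    have sums2: "(\<lambda>n. sqrt_coeff n * (norm x)\<^sup>2) sums (suminf sqrt_coeff * (norm x)\<^sup>2)"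
      by (intro sums_mult2 summable_sums summable_rabs_cancel[OF summable_abs_sqrt_coeff])
    \<comment> \<open>Replacing B^n by the identity can only lower each term: n = 0 gives equality,
      and for n > 0 the coefficient is nonpositive while (B^n x, x) <= ||x||^2.\<close>
    have "sqrt_coeff n * (norm x)\<^sup>2 \<le> inner ((sqrt_coeff n *\<^sub>R op_pow B n) x) x" for n
    proof (cases n)
      case 0
      then show ?thesis by (simp add: sqrt_coeff_0 power2_norm_eq_inner)
    next
      case (Suc m)
      have "norm (op_pow B n) \<le> 1"
        using norm_op_pow[of n B] power_le_one[OF norm_ge_zero normB] by (rule order_trans)
      then have "norm (op_pow B n x) \<le> 1 * norm x"
        by (intro order_trans[OF norm_blinfun] mult_right_mono) auto
      then have "norm (op_pow B n x) * norm x \<le> norm x * norm x"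
        by (simp add: mult_right_mono)
      then have "inner (op_pow B n x) x \<le> (norm x)\<^sup>2"
        using norm_cauchy_schwarz[of "op_pow B n x" x] by (simp add: power2_eq_square)
      then show ?thesis
        using sqrt_coeff_Suc_nonpos[of m] Suc
        by (auto simp: blinfun.scaleR_left intro!: mult_left_mono_neg)
    qed
    then have "suminf sqrt_coeff * (norm x)\<^sup>2 \<le> inner (S x) x"
      by (rule sums_le[OF _ sums2 sums1])
    moreover have "0 \<le> suminf sqrt_coeff * (norm x)\<^sup>2"
      using suminf_sqrt_coeff_nonneg by simp
    ultimately show "0 \<le> inner (S x) x" by linarith
  qed
  have "S o\<^sub>L S = op_series (\<lambda>n. (- 1) ^ n * real (1 choose n)) B"
    unfolding S_def op_series_mult[OF summ summ] sqrt_coeff_convolution ..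
  also have "\<dots> = (\<Sum>n<2. ((- 1) ^ n * real (1 choose n)) *\<^sub>R op_pow B n)"
    unfolding op_series_def by (rule suminf_finite) (auto simp: not_less binomial_eq_0)
  also have "\<dots> = id_blinfun - B"
    by (rule blinfun_eqI) (simp add: numeral_2_eq_2 blinfun.bilinear_simps)
  also have "\<dots> = (1 / k) *\<^sub>R A" by (simp add: B_def)
  finally have SS: "S (S x) = (1 / k) *\<^sub>R A x" for x
    by (metis blinfun_apply_blinfun_compose blinfun.scaleR_left)
  let ?R = "sqrt k *\<^sub>R S"
  have "?R o\<^sub>L ?R = A"
    using k by (intro blinfun_eqI) (simp add: blinfun.scaleR_left blinfun.scaleR_right SS)
  moreover have "self_adjoint ?R" using saS by (simp add: self_adjoint_def blinfun.scaleR_left)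
  moreover have "nonneg_op ?R" using nnS k by (simp add: nonneg_op_def blinfun.scaleR_left)
  ultimately show ?thesis by blast
qed

text \<open>Later proofs see \<open>op_sqrt\<close> only through this identity, which holds for
  whatever root the choice selects.\<close>

lemma norm_op_sqrt_power2:
  fixes A :: "'a::{real_inner, banach} \<Rightarrow>\<^sub>L 'a"
  assumes "self_adjoint A" and "nonneg_op A"
  shows "(norm (op_sqrt A x))\<^sup>2 = inner (A x) x"
proof -
  have S: "self_adjoint (op_sqrt A)" "op_sqrt A o\<^sub>L op_sqrt A = A"
    using someI_ex[OF nonneg_op_sqrt_exists[OF assms]] unfolding op_sqrt_def by blast+
  have "inner (op_sqrt A x) (op_sqrt A x) = inner (op_sqrt A (op_sqrt A x)) x"
    using S(1) by (simp add: self_adjoint_def)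
  also have "op_sqrt A (op_sqrt A x) = A x"
    using S(2) by (metis blinfun_apply_blinfun_compose)
  finally show ?thesis by (simp add: power2_norm_eq_inner)
qed


section \<open>The operator exponential\<close>

lemma op_exp_scaleR: "op_exp (t *\<^sub>R A) = op_series (\<lambda>n. t ^ n /\<^sub>R fact n) A"
  unfolding op_exp_def op_series_def op_pow_scaleR by (simp add: field_simps)

lemma op_abs_summable_exp: "op_abs_summable (\<lambda>n. t ^ n /\<^sub>R fact n) A"
  using summable_exp[of "\<bar>t\<bar> * norm A"] by (simp add: abs_mult power_abs power_mult_distrib mult.assoc)

text \<open>The Cauchy product reduces the group law to the scalar identity for the coefficients (s
  + t)^n / n!.\<close>

lemma op_exp_add: "op_exp ((s + t) *\<^sub>R A) = op_exp (s *\<^sub>R A) o\<^sub>L op_exp (t *\<^sub>R A)"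
  unfolding op_exp_scaleR op_series_mult[OF op_abs_summable_exp op_abs_summable_exp]
  by (subst exp_series_add_commuting) (auto simp: mult.commute)

lemma op_exp_zero: "op_exp 0 = id_blinfun"
proof -
  have "op_exp (0 *\<^sub>R A) = id_blinfun" for A :: "'a \<Rightarrow>\<^sub>L 'a"
    unfolding op_exp_scaleR op_series_def
    by (subst suminf_finite[where N = "{0}"]) auto
  then show ?thesis by simp
qed

lemma self_adjoint_op_exp: "self_adjoint A \<Longrightarrow> self_adjoint (op_exp (t *\<^sub>R A))"
  for A :: "'a::{real_inner, banach} \<Rightarrow>\<^sub>L 'a"
  unfolding op_exp_scaleR by (rule self_adjoint_op_series[OF _ op_abs_summable_exp])

text \<open>The series from index 2 on is dominated by the scalar tail exp r - 1 - r with r = |h|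
  ||A||, which is at most r^2 for r <= 1. Differentiability and norm continuity both rest on this
  bound.\<close>

lemma op_exp_first_order:
  assumes "\<bar>h\<bar> * norm A \<le> 1"
  shows "norm (op_exp (h *\<^sub>R A) - id_blinfun - h *\<^sub>R A) \<le> (\<bar>h\<bar> * norm A)\<^sup>2"
proof -
  let ?f = "\<lambda>n. (h ^ n /\<^sub>R fact n) *\<^sub>R op_pow A n" and ?r = "\<bar>h\<bar> * norm A"
  have "A o\<^sub>L id_blinfun = A" by (rule blinfun_eqI) simp
  then have sums1: "(\<lambda>n. ?f (n + 2)) sums (op_exp (h *\<^sub>R A) - id_blinfun - h *\<^sub>R A)"
    using sums_split_initial_segment[OF op_series_sums[OF op_abs_summable_exp], of 2 h A]
    by (simp add: op_exp_scaleR numeral_2_eq_2 diff_diff_eq)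
  have sums2: "(\<lambda>n. ?r ^ (n + 2) /\<^sub>R fact (n + 2)) sums (exp ?r - 1 - ?r)"
    using sums_split_initial_segment[OF exp_converges, of 2 ?r]
    by (simp add: numeral_2_eq_2 diff_diff_eq)
  have "norm (?f n) \<le> ?r ^ n /\<^sub>R fact n" for n
    using norm_op_series_term[of "\<lambda>n. h ^ n /\<^sub>R fact n" n A]
    by (simp add: abs_mult power_abs power_mult_distrib mult.assoc)
  then have "norm (op_exp (h *\<^sub>R A) - id_blinfun - h *\<^sub>R A) \<le> exp ?r - 1 - ?r"
    by (rule norm_sums_le[OF sums1 sums2])
  also have "\<dots> \<le> ?r\<^sup>2" using exp_bound[of ?r] assms by simp
  finally show ?thesis .
qed

lemma op_exp_commute: "op_exp (t *\<^sub>R A) (A x) = A (op_exp (t *\<^sub>R A) x)"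
proof -
  have comm: "op_pow A n (A x) = A (op_pow A n x)" for n
    by (induction n) auto
  have s: "(\<lambda>n. (t ^ n /\<^sub>R fact n) *\<^sub>R op_pow A n) sums op_exp (t *\<^sub>R A)"
    unfolding op_exp_scaleR by (rule op_series_sums[OF op_abs_summable_exp])
  have "(\<lambda>n. A (((t ^ n /\<^sub>R fact n) *\<^sub>R op_pow A n) x)) sums A (op_exp (t *\<^sub>R A) x)"
    by (intro bounded_linear.sums[OF blinfun.bounded_linear_right]
        bounded_linear.sums[OF blinfun.bounded_linear_left] s)
  moreover have "(\<lambda>n. ((t ^ n /\<^sub>R fact n) *\<^sub>R op_pow A n) (A x)) sums op_exp (t *\<^sub>R A) (A x)"
    by (intro bounded_linear.sums[OF blinfun.bounded_linear_left] s)
  ultimately show ?thesis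
    by (simp add: blinfun.scaleR_left blinfun.scaleR_right comm sums_unique2)
qed

lemma op_exp_has_vector_derivative:
  "((\<lambda>t. op_exp (t *\<^sub>R A) x) has_vector_derivative A (op_exp (t *\<^sub>R A) x)) (at t within S)"
  unfolding has_vector_derivative_def
proof (rule has_derivativeI_sandwich)
  \<comment> \<open>The radius \<open>?e\<close> forces |h| ||A|| <= 1, also when A = 0;
    \<open>?K\<close> is what remains of the quadratic remainder bound after division by
    h^2.\<close>
  let ?E = "\<lambda>t. op_exp (t *\<^sub>R A)" and ?e = "1 / (norm A + 1)"
  let ?K = "norm (?E t) * (norm A)\<^sup>2 * norm x"
  show "0 < ?e" by (simp add: add_nonneg_pos)
  show "bounded_linear (\<lambda>h. h *\<^sub>R A (?E t x))" by (rule bounded_linear_scaleR_left)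
  have "((\<lambda>y. ?K * \<bar>y - t\<bar>) \<longlongrightarrow> ?K * \<bar>t - t\<bar>) (at t within S)"
    by (intro tendsto_intros)
  then show "((\<lambda>y. ?K * \<bar>y - t\<bar>) \<longlongrightarrow> 0) (at t within S)" by simp
  fix y assume y: "y \<noteq> t" "dist y t < ?e"
  define h where "h = y - t"
  have h: "h \<noteq> 0" "\<bar>h\<bar> < ?e" using y by (auto simp: h_def dist_real_def)
  have "\<bar>h\<bar> * norm A \<le> ?e * (norm A + 1)" using h by (intro mult_mono) auto
  also have "\<dots> = 1" using norm_ge_zero[of A] by (auto simp: add_nonneg_eq_0_iff)
  finally have small: "\<bar>h\<bar> * norm A \<le> 1" .
  \<comment> \<open>The group law factors out \<open>?E t\<close>, which reduces the expansion at t
    to the one at 0.\<close>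
  have "?E y x - ?E t x - h *\<^sub>R A (?E t x) = ?E t ((?E h - id_blinfun - h *\<^sub>R A) x)"
    using op_exp_add[of t h A]
    by (simp add: h_def blinfun.diff_left blinfun.diff_right blinfun.scaleR_left blinfun.scaleR_right
        op_exp_commute)
  also have "norm \<dots> \<le> norm (?E t) * (norm (?E h - id_blinfun - h *\<^sub>R A) * norm x)"
    by (intro order_trans[OF norm_blinfun] mult_left_mono norm_blinfun) auto
  also have "\<dots> \<le> norm (?E t) * ((\<bar>h\<bar> * norm A)\<^sup>2 * norm x)"
    by (intro mult_left_mono mult_right_mono op_exp_first_order small) auto
  finally show "norm (?E y x - ?E t x - (y - t) *\<^sub>R A (?E t x)) / norm (y - t) \<le> ?K * \<bar>y - t\<bar>"
    using h by (simp add: h_def[symmetric] divide_simps power2_eq_square mult_ac)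
qed

text \<open>Continuity in operator norm, stronger than continuity of the orbits: it makes (s, y)
  \<mapsto> e^(sA) y jointly continuous and the operators bounded on compact intervals, as needed to
  integrate e^(sA) f(s).\<close>

lemma continuous_op_exp:
  "continuous_on S (\<lambda>t. op_exp (t *\<^sub>R A))"
proof (rule continuous_on_subset[of UNIV])
  have "isCont (\<lambda>t. op_exp (t *\<^sub>R A)) t" for t
  proof -
    let ?E = "\<lambda>t. op_exp (t *\<^sub>R A)"
    have "((\<lambda>h. norm (?E t) * ((\<bar>h\<bar> * norm A)\<^sup>2 + \<bar>h\<bar> * norm A)) \<longlongrightarrow>
        norm (?E t) * ((\<bar>0\<bar> * norm A)\<^sup>2 + \<bar>0\<bar> * norm A)) (at 0)"
      by (intro tendsto_intros)
    then have lim: "((\<lambda>h. norm (?E t) * ((\<bar>h\<bar> * norm A)\<^sup>2 + \<bar>h\<bar> * norm A)) \<longlongrightarrow> 0) (at 0)"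
      by simp
    have "((\<lambda>h. \<bar>h\<bar> * norm A) \<longlongrightarrow> \<bar>0\<bar> * norm A) (at 0)" by (intro tendsto_intros)
    then have "\<forall>\<^sub>F h in at 0. \<bar>h\<bar> * norm A < 1" by (rule order_tendstoD) simp
    then have "\<forall>\<^sub>F h in at 0. norm (?E (t + h) - ?E t) \<le>
        norm (?E t) * ((\<bar>h\<bar> * norm A)\<^sup>2 + \<bar>h\<bar> * norm A)"
    proof eventually_elim
      case (elim h)
      have "?E (t + h) - ?E t = ?E t o\<^sub>L (?E h - id_blinfun)"
        by (rule blinfun_eqI) (simp add: op_exp_add blinfun.diff_left blinfun.diff_right)
      then have "norm (?E (t + h) - ?E t) \<le> norm (?E t) * norm (?E h - id_blinfun)"
        by (simp add: norm_blinfun_compose)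
      also have "norm (?E h - id_blinfun) \<le> norm (?E h - id_blinfun - h *\<^sub>R A) + norm (h *\<^sub>R A)"
        using norm_triangle_ineq[of "?E h - id_blinfun - h *\<^sub>R A" "h *\<^sub>R A"] by simp
      also have "\<dots> \<le> (\<bar>h\<bar> * norm A)\<^sup>2 + \<bar>h\<bar> * norm A"
        using op_exp_first_order[of h A] elim by simp
      finally show ?case by (simp add: mult_left_mono)
    qed
    then have "((\<lambda>h. ?E (t + h) - ?E t) \<longlongrightarrow> 0) (at 0)"
      using lim by (rule Lim_null_comparison)
    then show ?thesis unfolding isCont_iff by (rule LIM_zero_cancel)
  qed
  then show "continuous_on UNIV (\<lambda>t. op_exp (t *\<^sub>R A))"
    by (simp add: continuous_at_imp_continuous_on)
qed simp


section \<open>Integration by parts for Bochner integrals\<close>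

text \<open>The integrands are only Lebesgue measurable, so Fubini is applied to the product of two
  completed measures, each of which must be sigma-finite.\<close>

lemma sigma_finite_completion:
  assumes "sigma_finite_measure M"
  shows "sigma_finite_measure (completion M)"
proof -
  obtain A where A: "countable A" "A \<subseteq> sets M" "\<Union>A = space M" "\<forall>a\<in>A. emeasure M a \<noteq> \<infinity>"
    using sigma_finite_measure.sigma_finite_countable[OF assms] by blast
  show ?thesis
  proof
    show "\<exists>A. countable A \<and> A \<subseteq> sets (completion M) \<and> \<Union>A = space (completion M) \<and>
        (\<forall>a\<in>A. emeasure (completion M) a \<noteq> \<infinity>)"
      using A by (intro exI[of _ A]) (auto dest: subsetD)
  qed
qed

interpretation lebesgue_pair:
  pair_sigma_finite "lebesgue :: real measure" "lebesgue :: real measure"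
  by (intro pair_sigma_finite.intro sigma_finite_completion sigma_finite_lborel)

lemma AE_lebesgue_singleton: "AE x in lebesgue. x \<noteq> (c :: real)"
  by (rule AE_completion[OF AE_lborel_singleton])

lemma bounded_bilinear_measurable:
  fixes prod :: "'a::{real_normed_vector, second_countable_topology} \<Rightarrow>
    'b::{real_normed_vector, second_countable_topology} \<Rightarrow> 'c::real_normed_vector"
  assumes prod: "bounded_bilinear prod"
    and "f \<in> borel_measurable M" "g \<in> borel_measurable M"
  shows "(\<lambda>x. prod (f x) (g x)) \<in> borel_measurable M"
  using assms(2,3)
  by (rule borel_measurable_continuous_Pair)
    (intro bounded_bilinear.continuous_on[OF prod] continuous_intros)

lemma set_integrable_bounded_bilinear:
  fixes prod :: "'a::{banach, second_countable_topology} \<Rightarrow>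
    'b::{banach, second_countable_topology} \<Rightarrow> 'c::{banach, second_countable_topology}"
  assumes prod: "bounded_bilinear prod"
    and f: "set_integrable lebesgue {a..b::real} f" and h: "continuous_on {a..b} h"
  shows "set_integrable lebesgue {a..b} (\<lambda>t. prod (f t) (h t))"
proof -
  interpret bounded_bilinear prod by fact
  obtain K where K: "0 \<le> K" "\<And>x y. norm (prod x y) \<le> norm x * norm y * K"
    using nonneg_bounded by blast
  have "compact (h ` {a..b})" using h by (intro compact_continuous_image) auto
  then obtain B where B: "\<And>t. t \<in> {a..b} \<Longrightarrow> norm (h t) \<le> B"
    by (metis compact_imp_bounded bounded_iff imageI)
  show ?thesis
  proof (rule set_integrable_bound[where f = "\<lambda>t. (B * K) *\<^sub>R f t"])
    show "set_integrable lebesgue {a..b} (\<lambda>t. (B * K) *\<^sub>R f t)" using f by simp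
    \<comment> \<open>Cutting off both factors makes each measurable on the whole line; the result
      is the cut-off product because \<open>prod\<close> vanishes when an argument is 0.\<close>
    have "(\<lambda>t. prod (indicator {a..b} t *\<^sub>R f t) (indicator {a..b} t *\<^sub>R h t)) \<in> borel_measurable lebesgue"
    proof (rule bounded_bilinear_measurable[OF prod])
      show "(\<lambda>t. indicator {a..b} t *\<^sub>R f t) \<in> borel_measurable lebesgue"
        using f by (simp add: set_integrable_def borel_measurable_integrable)
      show "(\<lambda>t. indicator {a..b} t *\<^sub>R h t) \<in> borel_measurable lebesgue"
        by (intro measurable_completion)
          (use borel_measurable_continuous_on_indicator[OF _ h] in simp)
    qed
    then show "set_borel_measurable lebesgue {a..b} (\<lambda>t. prod (f t) (h t))"
      unfolding set_borel_measurable_def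
      by (rule measurable_cong[THEN iffD1, rotated]) (auto simp: indicator_def zero_left)
    have "norm (prod (f t) (h t)) \<le> norm ((B * K) *\<^sub>R f t)" if "t \<in> {a..b}" for t
    proof -
      have "norm (prod (f t) (h t)) \<le> norm (f t) * norm (h t) * K" by (rule K)
      also have "\<dots> \<le> norm (f t) * B * K"
        using B[OF that] K by (intro mult_right_mono mult_left_mono) auto
      also have "\<dots> \<le> norm ((B * K) *\<^sub>R f t)"
        using order_trans[OF norm_ge_zero B[OF that]] K by (simp add: mult_ac)
      finally show ?thesis .
    qed
    then show "AE t in lebesgue. t \<in> {a..b} \<longrightarrow> norm (prod (f t) (h t)) \<le> norm ((B * K) *\<^sub>R f t)"
      by simp
  qed
qed

lemma set_integrable_continuous_lebesgue:
  fixes h :: "real \<Rightarrow> 'a::{banach, second_countable_topology}"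
  assumes "continuous_on {a..b} h"
  shows "set_integrable lebesgue {a..b} h"
proof -
  have "set_integrable lebesgue {a..b} (\<lambda>t. 1 :: real)"
    unfolding set_integrable_def using lmeasurable_cbox[of a b]
    by (simp add: fmeasurable_def)
  from set_integrable_bounded_bilinear[OF bounded_bilinear_scaleR this assms]
  show ?thesis by simp
qed

lemma continuous_on_set_lebesgue_integral:
  fixes g :: "real \<Rightarrow> 'a::{banach, second_countable_topology}"
  assumes g: "set_integrable lebesgue {a..b} g"
  shows "continuous_on {a..b} (\<lambda>t. LINT s:{a..t}|lebesgue. g s)"
  unfolding continuous_on_sequentially
proof (intro allI ballI impI)
  fix X :: "nat \<Rightarrow> real" and t assume t: "t \<in> {a..b}" and X: "(\<forall>n. X n \<in> {a..b}) \<and> X \<longlonglongrightarrow> t"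
  have meas: "(\<lambda>s. indicator {a..u} s *\<^sub>R g s) \<in> borel_measurable lebesgue" if "u \<in> {a..b}" for u
    using set_integrable_subset[OF g, of "{a..u}"] that by (auto simp: set_integrable_def)
  have "(\<lambda>n. LINT s|lebesgue. indicator {a..X n} s *\<^sub>R g s) \<longlonglongrightarrow>
      (LINT s|lebesgue. indicator {a..t} s *\<^sub>R g s)"
  proof (rule integral_dominated_convergence[where w = "\<lambda>s. norm (indicator {a..b} s *\<^sub>R g s)"])
    show "(\<lambda>s. indicator {a..t} s *\<^sub>R g s) \<in> borel_measurable lebesgue" by (rule meas[OF t])
    show "(\<lambda>s. indicator {a..X n} s *\<^sub>R g s) \<in> borel_measurable lebesgue" for n
      using X by (intro meas) auto
    show "integrable lebesgue (\<lambda>s. norm (indicator {a..b} s *\<^sub>R g s))"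
      using g unfolding set_integrable_def by (rule integrable_norm)
    show "AE s in lebesgue. norm (indicator {a..X n} s *\<^sub>R g s) \<le> norm (indicator {a..b} s *\<^sub>R g s)" for n
      using X by (intro AE_I2) (auto simp: indicator_def dest!: spec[of _ n])
    \<comment> \<open>For s different from t the indicators are eventually constant; at s = t they
      may oscillate, but a single point is a null set.\<close>
    show "AE s in lebesgue. (\<lambda>n. indicator {a..X n} s *\<^sub>R g s) \<longlonglongrightarrow> indicator {a..t} s *\<^sub>R g s"
      using AE_lebesgue_singleton[of t]
    proof eventually_elim
      case (elim s)
      then consider "s < t" | "t < s" by linarith
      then have "\<forall>\<^sub>F n in sequentially. indicator {a..X n} s *\<^sub>R g s = indicator {a..t} s *\<^sub>R g s"
      proof cases
        case 1
        then have "\<forall>\<^sub>F n in sequentially. s < X n" using X by (blast intro: order_tendstoD)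
        then show ?thesis by eventually_elim (use 1 in \<open>auto simp: indicator_def\<close>)
      next
        case 2
        then have "\<forall>\<^sub>F n in sequentially. X n < s" using X by (blast intro: order_tendstoD)
        then show ?thesis by eventually_elim (use 2 in \<open>auto simp: indicator_def\<close>)
      qed
      then show ?case by (rule tendsto_eventually)
    qed
  qed
  then show "((\<lambda>t. LINT s:{a..t}|lebesgue. g s) \<circ> X) \<longlonglongrightarrow> (LINT s:{a..t}|lebesgue. g s)"
    by (simp add: set_lebesgue_integral_def o_def)
qed

lemma set_lebesgue_integral_split:
  fixes g :: "real \<Rightarrow> 'a::{banach, second_countable_topology}"
  assumes g: "set_integrable lebesgue {a..b} g" and t: "t \<in> {a..b}"
  shows "(LINT s:{a..b}|lebesgue. g s) = (LINT s:{a..t}|lebesgue. g s) + (LINT s:{t..b}|lebesgue. g s)"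
proof -
  have i1: "integrable lebesgue (\<lambda>s. indicator {a..t} s *\<^sub>R g s)"
    and i2: "integrable lebesgue (\<lambda>s. indicator {t..b} s *\<^sub>R g s)"
    using set_integrable_subset[OF g, of "{a..t}"] set_integrable_subset[OF g, of "{t..b}"] t
    by (auto simp: set_integrable_def)
  have "(LINT s|lebesgue. indicator {a..b} s *\<^sub>R g s) =
      (LINT s|lebesgue. indicator {a..t} s *\<^sub>R g s + indicator {t..b} s *\<^sub>R g s)"
  proof (rule integral_cong_AE)
    show "AE s in lebesgue. indicator {a..b} s *\<^sub>R g s =
        indicator {a..t} s *\<^sub>R g s + indicator {t..b} s *\<^sub>R g s"
      using AE_lebesgue_singleton[of t] by eventually_elim (use t in \<open>auto simp: indicator_def\<close>)
  qed (use g i1 i2 in \<open>auto simp: set_integrable_def intro!: borel_measurable_add\<close>)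
  also have "\<dots> = (LINT s|lebesgue. indicator {a..t} s *\<^sub>R g s) +
      (LINT s|lebesgue. indicator {t..b} s *\<^sub>R g s)"
    by (rule Bochner_Integration.integral_add[OF i1 i2])
  finally show ?thesis by (simp add: set_lebesgue_integral_def)
qed

text \<open>Both sides are iterated integrals of \<open>prod (f t) (g s)\<close> over the triangle a
  <= t <= s <= b.\<close>

lemma set_lebesgue_integral_fubini_triangle:
  fixes prod :: "'a::{banach, second_countable_topology} \<Rightarrow>
    'b::{banach, second_countable_topology} \<Rightarrow> 'c::{banach, second_countable_topology}"
  assumes prod: "bounded_bilinear prod"
    and f: "set_integrable lebesgue {a..b::real} f" and g: "set_integrable lebesgue {a..b} g"
  shows "(LINT t:{a..b}|lebesgue. prod (f t) (LINT s:{t..b}|lebesgue. g s)) =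
    (LINT s:{a..b}|lebesgue. prod (LINT t:{a..s}|lebesgue. f t) (g s))"
proof -
  interpret bounded_bilinear prod by fact
  obtain K where K: "0 \<le> K" "\<And>x y. norm (prod x y) \<le> norm x * norm y * K"
    using nonneg_bounded by blast
  define f0 where "f0 t = indicator {a..b} t *\<^sub>R f t" for t
  define g0 where "g0 t = indicator {a..b} t *\<^sub>R g t" for t
  have f0: "integrable lebesgue f0" and g0: "integrable lebesgue g0"
    using f g by (simp_all add: f0_def[abs_def] g0_def[abs_def] set_integrable_def)
  define h where "h = (\<lambda>(t, s). indicator {p. fst p \<le> snd p} (t, s) *\<^sub>R prod (f0 t) (g0 s))"
  have id: "(\<lambda>x. x) \<in> borel_measurable lebesgue" by (rule measurable_completion) simp
  have [measurable]: "fst \<in> borel_measurable (lebesgue \<Otimes>\<^sub>M lebesgue :: (real \<times> real) measure)"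
      "snd \<in> borel_measurable (lebesgue \<Otimes>\<^sub>M lebesgue :: (real \<times> real) measure)"
    by (rule measurable_compose[OF measurable_fst id], rule measurable_compose[OF measurable_snd id])
  have "{p \<in> space (lebesgue \<Otimes>\<^sub>M lebesgue). fst p \<le> snd p} \<in> sets (lebesgue \<Otimes>\<^sub>M lebesgue :: (real \<times> real) measure)"
    by measurable
  then have tri: "{p. fst p \<le> snd p} \<in> sets (lebesgue \<Otimes>\<^sub>M lebesgue :: (real \<times> real) measure)"
    by (simp add: space_pair_measure)
  have meas: "h \<in> borel_measurable (lebesgue \<Otimes>\<^sub>M lebesgue)"
    unfolding h_def case_prod_beta
    by (intro borel_measurable_scaleR borel_measurable_indicator bounded_bilinear_measurable[OF prod]
        measurable_compose[OF measurable_fst borel_measurable_integrable[OF f0]]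
        measurable_compose[OF measurable_snd borel_measurable_integrable[OF g0]])
      (simp add: tri)
  have hs: "h (t, s) = prod (f0 t) (indicator {t..} s *\<^sub>R g0 s)" for t s
    by (simp add: h_def indicator_def scaleR_right zero_right)
  have ht: "h (t, s) = prod (indicator {..s} t *\<^sub>R f0 t) (g0 s)" for t s
    by (simp add: h_def indicator_def scaleR_left zero_left)
  have ig0: "integrable lebesgue (\<lambda>s. indicator {t..} s *\<^sub>R g0 s)" for t
    using g0 by (intro integrable_mult_indicator) auto
  have if0: "integrable lebesgue (\<lambda>t. indicator {..s} t *\<^sub>R f0 t)" for s
    using f0 by (intro integrable_mult_indicator) auto
  have int1: "integrable lebesgue (\<lambda>s. h (t, s))" for t
    unfolding hs by (rule integrable_bounded_linear[OF bounded_linear_right ig0])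
  have "integrable (lebesgue \<Otimes>\<^sub>M lebesgue) h"
  proof (rule lebesgue_pair.Fubini_integrable[OF meas])
    show "integrable lebesgue (\<lambda>t. LINT s|lebesgue. norm (h (t, s)))"
    proof (rule Bochner_Integration.integrable_bound)
      \<comment> \<open>Majorant for the inner integrals: drop the triangle and use the bound
        \<open>K\<close> of \<open>prod\<close>.\<close>
      show "integrable lebesgue (\<lambda>t. norm (f0 t) * ((LINT s|lebesgue. norm (g0 s)) * K))"
        using f0 by (intro integrable_mult_left integrable_norm)
      show "(\<lambda>t. LINT s|lebesgue. norm (h (t, s))) \<in> borel_measurable lebesgue"
        using meas by (intro sigma_finite_measure.borel_measurable_lebesgue_integral
            sigma_finite_completion sigma_finite_lborel) (simp add: borel_measurable_norm)
      have "(LINT s|lebesgue. norm (h (t, s))) \<le> norm (f0 t) * ((LINT s|lebesgue. norm (g0 s)) * K)" for t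
      proof -
        have "(LINT s|lebesgue. norm (h (t, s))) \<le> (LINT s|lebesgue. norm (f0 t) * (norm (g0 s) * K))"
        proof (rule integral_mono)
          show "integrable lebesgue (\<lambda>s. norm (f0 t) * (norm (g0 s) * K))"
            using g0 by (intro integrable_mult_left integrable_mult_right integrable_norm)
          show "norm (h (t, s)) \<le> norm (f0 t) * (norm (g0 s) * K)" for s
            using K(2)[of "f0 t" "g0 s"] K(1) by (auto simp: h_def indicator_def mult_ac)
        qed (intro integrable_norm int1)
        then show ?thesis by simp
      qed
      moreover have "0 \<le> (LINT s|lebesgue. norm (h (t, s)))" for t
        by (rule integral_nonneg_AE) auto
      ultimately show "AE t in lebesgue. norm (LINT s|lebesgue. norm (h (t, s))) \<le>
          norm (norm (f0 t) * ((LINT s|lebesgue. norm (g0 s)) * K))"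
        by (intro AE_I2) (smt (verit) real_norm_def)
    qed
  qed (intro AE_I2 int1)
  then have "(LINT s|lebesgue. LINT t|lebesgue. h (t, s)) = (LINT t|lebesgue. LINT s|lebesgue. h (t, s))"
    using lebesgue_pair.Fubini_integral[of "\<lambda>t s. h (t, s)"] by simp
  moreover have "(LINT s|lebesgue. h (t, s)) = indicator {a..b} t *\<^sub>R prod (f t) (LINT s:{t..b}|lebesgue. g s)" for t
  proof -
    have "(LINT s|lebesgue. h (t, s)) = prod (f0 t) (LINT s|lebesgue. indicator {t..} s *\<^sub>R g0 s)"
      unfolding hs by (rule integral_bounded_linear[OF bounded_linear_right ig0])
    also have "\<dots> = indicator {a..b} t *\<^sub>R prod (f t) (LINT s:{t..b}|lebesgue. g s)"
    proof (cases "t \<in> {a..b}")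
      case True
      then have "indicator {t..} s *\<^sub>R g0 s = indicator {t..b} s *\<^sub>R g s" for s
        by (auto simp: g0_def indicator_def)
      then show ?thesis using True by (simp add: f0_def set_lebesgue_integral_def)
    qed (simp add: f0_def zero_left)
    finally show ?thesis .
  qed
  moreover have "(LINT t|lebesgue. h (t, s)) = indicator {a..b} s *\<^sub>R prod (LINT t:{a..s}|lebesgue. f t) (g s)" for s
  proof -
    have "(LINT t|lebesgue. h (t, s)) = prod (LINT t|lebesgue. indicator {..s} t *\<^sub>R f0 t) (g0 s)"
      unfolding ht by (rule integral_bounded_linear[OF bounded_linear_left if0])
    also have "\<dots> = indicator {a..b} s *\<^sub>R prod (LINT t:{a..s}|lebesgue. f t) (g s)"
    proof (cases "s \<in> {a..b}")
      case True
      then have "indicator {..s} t *\<^sub>R f0 t = indicator {a..s} t *\<^sub>R f t" for t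
        by (auto simp: f0_def indicator_def)
      then show ?thesis using True by (simp add: g0_def set_lebesgue_integral_def)
    qed (simp add: g0_def zero_right)
    finally show ?thesis .
  qed
  ultimately show ?thesis by (simp add: set_lebesgue_integral_def[of _ "{a..b}"])
qed

text \<open>Inserting G(b) - G(t) for the integral of \<open>g\<close> over [t, b] in the triangle
  identity gives the claim. There is no boundary term at a because both primitives vanish
  there.\<close>

lemma set_lebesgue_integral_by_parts:
  fixes prod :: "'a::{banach, second_countable_topology} \<Rightarrow>
    'b::{banach, second_countable_topology} \<Rightarrow> 'c::{banach, second_countable_topology}"
  assumes prod: "bounded_bilinear prod"
    and f: "set_integrable lebesgue {a..b::real} f" and g: "set_integrable lebesgue {a..b} g"
  defines "F \<equiv> \<lambda>t. LINT s:{a..t}|lebesgue. f s" and "G \<equiv> \<lambda>t. LINT s:{a..t}|lebesgue. g s"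
  shows "(LINT t:{a..b}|lebesgue. prod (f t) (G t)) + (LINT t:{a..b}|lebesgue. prod (F t) (g t)) =
    prod (F b) (G b)"
proof -
  interpret bounded_bilinear prod by fact
  have "continuous_on {a..b} G" unfolding G_def by (rule continuous_on_set_lebesgue_integral[OF g])
  note fG = set_integrable_bounded_bilinear[OF prod f this]
    and fc = set_integrable_bounded_bilinear[OF prod f continuous_on_const, of "G b"]
  have "(LINT t:{a..b}|lebesgue. prod (F t) (g t)) =
      (LINT t:{a..b}|lebesgue. prod (f t) (LINT s:{t..b}|lebesgue. g s))"
    unfolding F_def by (rule set_lebesgue_integral_fubini_triangle[OF prod f g, symmetric])
  also have "\<dots> = (LINT t:{a..b}|lebesgue. prod (f t) (G b) - prod (f t) (G t))"
    using set_lebesgue_integral_split[OF g]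
    by (intro set_lebesgue_integral_cong) (auto simp: G_def diff_right[symmetric])
  also have "\<dots> = (LINT t:{a..b}|lebesgue. prod (f t) (G b)) - (LINT t:{a..b}|lebesgue. prod (f t) (G t))"
    by (rule set_integral_diff(2)[OF fc fG])
  also have "(LINT t:{a..b}|lebesgue. prod (f t) (G b)) = prod (F b) (G b)"
    using integral_bounded_linear[OF bounded_linear_left f[unfolded set_integrable_def]]
    by (simp add: F_def set_lebesgue_integral_def scaleR_left)
  finally show ?thesis by simp
qed

lemma set_lebesgue_integral_bounded_linear:
  fixes f :: "'c \<Rightarrow> 'a::{banach, second_countable_topology}"
    and A :: "'a \<Rightarrow> 'b::{banach, second_countable_topology}"
  assumes "bounded_linear A" and f: "set_integrable M S f"
  shows "set_integrable M S (\<lambda>t. A (f t))"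
    and "(LINT t:S|M. A (f t)) = A (LINT t:S|M. f t)"
proof -
  interpret bounded_linear A by fact
  show "set_integrable M S (\<lambda>t. A (f t))"
    using integrable_bounded_linear[OF assms(1) f[unfolded set_integrable_def]]
    by (simp add: set_integrable_def scaleR)
  show "(LINT t:S|M. A (f t)) = A (LINT t:S|M. f t)"
    using integral_bounded_linear[OF assms(1) f[unfolded set_integrable_def]]
    by (simp add: set_lebesgue_integral_def scaleR)
qed

text \<open>Operator-valued \<open>U\<close> is not covered by the bilinear lemma, whose factors lie
  in second countable spaces. Measurability comes instead from composing the jointly continuous map
  (s, y) \<mapsto> U(s) y with the measurable pair (s, f(s)).\<close>

lemma set_integrable_blinfun_apply:
  fixes U :: "real \<Rightarrow> 'a::{banach, second_countable_topology} \<Rightarrow>\<^sub>L 'b::{banach, second_countable_topology}"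
  assumes U: "continuous_on UNIV U" and f: "set_integrable lebesgue {a..b} f"
  shows "set_integrable lebesgue {a..b} (\<lambda>s. U s (f s))"
proof -
  have "compact (U ` {a..b})"
    by (intro compact_continuous_image continuous_on_subset[OF U]) auto
  then obtain B where B: "\<And>s. s \<in> {a..b} \<Longrightarrow> norm (U s) \<le> B"
    by (metis compact_imp_bounded bounded_iff imageI)
  show ?thesis
  proof (rule set_integrable_bound[where f = "\<lambda>t. B *\<^sub>R f t"])
    show "set_integrable lebesgue {a..b} (\<lambda>t. B *\<^sub>R f t)" using f by simp
    have "(\<lambda>s. U s (indicator {a..b} s *\<^sub>R f s)) \<in> borel_measurable lebesgue"
    proof (rule borel_measurable_continuous_Pair[where H = "\<lambda>s y. U s y"])
      show "(\<lambda>s. s) \<in> borel_measurable lebesgue" by (rule measurable_completion) simp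
      show "(\<lambda>s. indicator {a..b} s *\<^sub>R f s) \<in> borel_measurable lebesgue"
        using f by (simp add: set_integrable_def borel_measurable_integrable)
      show "continuous_on UNIV (\<lambda>p. U (fst p) (snd p))"
        by (intro continuous_intros continuous_on_compose2[OF U]) auto
    qed
    then show "set_borel_measurable lebesgue {a..b} (\<lambda>s. U s (f s))"
      by (simp add: set_borel_measurable_def blinfun.scaleR_right)
    have "norm (U s (f s)) \<le> norm (B *\<^sub>R f s)" if "s \<in> {a..b}" for s
    proof -
      have "norm (U s (f s)) \<le> norm (U s) * norm (f s)" by (rule norm_blinfun)
      also have "\<dots> \<le> \<bar>B\<bar> * norm (f s)" using B[OF that] by (intro mult_right_mono) auto
      finally show ?thesis by simp
    qed
    then show "AE s in lebesgue. s \<in> {a..b} \<longrightarrow> norm (U s (f s)) \<le> norm (B *\<^sub>R f s)"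
      by simp
  qed
qed

text \<open>Pairing with \<open>z\<close> reduces to real-valued functions, for which the Bochner
  integral equals the gauge integral and the classical theorem applies.\<close>

lemma set_lebesgue_integral_FTC:
  fixes F :: "real \<Rightarrow> 'a::{real_inner, banach, second_countable_topology}"
  assumes ab: "a \<le> b"
    and F: "\<And>t. t \<in> {a..b} \<Longrightarrow> (F has_vector_derivative F' t) (at t within {a..b})"
    and F': "continuous_on {a..b} F'"
  shows "(LINT t:{a..b}|lebesgue. F' t) = F b - F a"
proof (subst vector_eq_rdot[symmetric], intro allI)
  fix z
  note int = set_integrable_continuous_lebesgue[OF F']
  note inner_int = set_lebesgue_integral_bounded_linear[OF bounded_linear_inner_left[of z] int]
  have "inner (LINT t:{a..b}|lebesgue. F' t) z = (LINT t:{a..b}|lebesgue. inner (F' t) z)"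
    by (rule inner_int(2)[symmetric])
  also have "\<dots> = integral {a..b} (\<lambda>t. inner (F' t) z)"
    by (rule set_lebesgue_integral_eq_integral(2)[OF inner_int(1)])
  also have "\<dots> = inner (F b) z - inner (F a) z"
    by (intro integral_unique fundamental_theorem_of_calculus ab
        bounded_linear.has_vector_derivative[OF bounded_linear_inner_left] F) auto
  finally show "inner (LINT t:{a..b}|lebesgue. F' t) z = inner (F b - F a) z"
    by (simp add: inner_diff_left)
qed

section \<open>Square-integrable functions and weak derivatives\<close>

lemma in_L2_imp_set_integrable:
  assumes "in_L2 T u"
  shows "set_integrable lebesgue {0..T} u"
proof (rule set_integrable_bound[where f = "\<lambda>t. 1 + (norm (u t))\<^sup>2"])
  show "set_integrable lebesgue {0..T} (\<lambda>t. 1 + (norm (u t))\<^sup>2)"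
    using assms
    by (intro set_integral_add(1)[OF set_integrable_continuous_lebesgue[OF continuous_on_const]])
      (simp add: in_L2_def)
  show "set_borel_measurable lebesgue {0..T} u" using assms by (simp add: in_L2_def)
  have "norm (u t) \<le> norm (1 + (norm (u t))\<^sup>2)" for t
    using sum_power2_ge_zero[of "norm (u t) - 1" "norm (u t)"]
      zero_le_power2[of "norm (u t) - 1"] by (simp add: power2_diff)
  then show "AE t in lebesgue. t \<in> {0..T} \<longrightarrow> norm (u t) \<le> norm (1 + (norm (u t))\<^sup>2)"
    by simp
qed

lemma continuous_imp_in_L2:
  assumes "continuous_on {0..T} u"
  shows "in_L2 T u"
proof -
  have "set_integrable lebesgue {0..T} u" "set_integrable lebesgue {0..T} (\<lambda>t. (norm (u t))\<^sup>2)"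
    by (intro set_integrable_continuous_lebesgue continuous_intros assms)+
  then show ?thesis
    by (simp add: in_L2_def set_borel_measurable_def set_integrable_def borel_measurable_integrable)
qed

lemma in_L2_bounded:
  assumes u: "set_borel_measurable lebesgue {0..T} u"
    and le: "\<And>t. t \<in> {0..T} \<Longrightarrow> (norm (u t))\<^sup>2 \<le> w t"
    and w: "set_integrable lebesgue {0..T} (w :: real \<Rightarrow> real)"
  shows "in_L2 T u"
proof -
  have "(\<lambda>t. (norm (indicator {0..T} t *\<^sub>R u t))\<^sup>2) \<in> borel_measurable lebesgue"
    using u unfolding set_borel_measurable_def by measurable
  then have "set_borel_measurable lebesgue {0..T} (\<lambda>t. (norm (u t))\<^sup>2)"
    unfolding set_borel_measurable_def
    by (rule measurable_cong[THEN iffD1, rotated]) (auto simp: indicator_def)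
  then have "set_integrable lebesgue {0..T} (\<lambda>t. (norm (u t))\<^sup>2)"
    by (rule set_integrable_bound[OF w]) (use order_trans[OF le abs_ge_self] in simp)
  then show ?thesis using u by (simp add: in_L2_def)
qed

lemma in_L2_blinfun:
  fixes A :: "'a::{real_inner, banach, second_countable_topology} \<Rightarrow>\<^sub>L 'b::{real_inner, banach, second_countable_topology}"
  assumes u: "in_L2 T u"
  shows "in_L2 T (\<lambda>t. A (u t))"
proof (rule in_L2_bounded[where w = "\<lambda>t. (norm A)\<^sup>2 * (norm (u t))\<^sup>2"])
  have "set_integrable lebesgue {0..T} (\<lambda>t. A (u t))"
    by (rule set_lebesgue_integral_bounded_linear(1)[OF blinfun.bounded_linear_right
          in_L2_imp_set_integrable[OF u]])
  then show "set_borel_measurable lebesgue {0..T} (\<lambda>t. A (u t))"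
    by (simp add: set_borel_measurable_def set_integrable_def borel_measurable_integrable)
  show "(norm (A (u t)))\<^sup>2 \<le> (norm A)\<^sup>2 * (norm (u t))\<^sup>2" for t
    using power_mono[OF norm_blinfun[of A "u t"], of 2] by (simp add: power_mult_distrib)
  show "set_integrable lebesgue {0..T} (\<lambda>t. (norm A)\<^sup>2 * (norm (u t))\<^sup>2)"
    using u by (simp add: in_L2_def)
qed

lemma in_L2_diff:
  assumes u: "in_L2 T u" and v: "in_L2 T v"
  shows "in_L2 T (\<lambda>t. u t - v t)"
proof (rule in_L2_bounded[where w = "\<lambda>t. 2 * (norm (u t))\<^sup>2 + 2 * (norm (v t))\<^sup>2"])
  have "set_integrable lebesgue {0..T} (\<lambda>t. u t - v t)"
    by (intro set_integral_diff in_L2_imp_set_integrable u v)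
  then show "set_borel_measurable lebesgue {0..T} (\<lambda>t. u t - v t)"
    by (simp add: set_borel_measurable_def set_integrable_def borel_measurable_integrable)
  show "(norm (u t - v t))\<^sup>2 \<le> 2 * (norm (u t))\<^sup>2 + 2 * (norm (v t))\<^sup>2" for t
  proof -
    have "(norm (u t - v t))\<^sup>2 \<le> (norm (u t) + norm (v t))\<^sup>2"
      by (intro power_mono norm_triangle_ineq4) simp
    also have "\<dots> \<le> 2 * (norm (u t))\<^sup>2 + 2 * (norm (v t))\<^sup>2"
      using zero_le_power2[of "norm (u t) - norm (v t)"] by (simp add: power2_sum power2_diff)
    finally show ?thesis .
  qed
  show "set_integrable lebesgue {0..T} (\<lambda>t. 2 * (norm (u t))\<^sup>2 + 2 * (norm (v t))\<^sup>2)"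
    using u v by (intro set_integral_add) (auto simp: in_L2_def)
qed

text \<open>Integration by parts of \<phi>' against \<open>g\<close>: the primitive of \<phi>' is
  \<phi> because \<phi>(0) = 0, and the boundary term vanishes because \<phi>(T) = 0.\<close>

lemma has_weak_deriv_indefinite_integral:
  fixes g :: "real \<Rightarrow> 'a::{real_inner, banach, second_countable_topology}"
  assumes T: "0 < T" and g: "set_integrable lebesgue {0..T} g"
    and u: "\<And>t. t \<in> {0..T} \<Longrightarrow> u t = (LINT s:{0..t}|lebesgue. g s)"
  shows "has_weak_deriv T u g"
  unfolding has_weak_deriv_def
proof (intro conjI allI impI g)
  have "continuous_on {0..T} u"
    by (rule continuous_on_eq[OF continuous_on_set_lebesgue_integral[OF g]]) (simp add: u)
  then show "set_integrable lebesgue {0..T} u" by (rule set_integrable_continuous_lebesgue)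
  fix \<phi> assume "test_function T \<phi>"
  then have diff: "\<And>n t. (deriv ^^ n) \<phi> differentiable (at t)"
    and supp: "closure {t. \<phi> t \<noteq> 0} \<subseteq> {0<..<T}" by (auto simp: test_function_def)
  have zero: "\<phi> t = 0" if "t \<notin> {0<..<T}" for t
    using supp closure_subset[of "{t. \<phi> t \<noteq> 0}"] that by blast
  have D: "(\<phi> has_vector_derivative deriv \<phi> t) (at t within S)" for t S
    using diff[of 0 t]
    by (simp add: has_field_derivative_at_within DERIV_deriv_iff_real_differentiable
        flip: has_real_derivative_iff_has_vector_derivative)
  have "isCont (deriv \<phi>) t" for t
    using differentiable_imp_continuous_within[OF diff[of 1 t]] by simp
  then have cont: "continuous_on S (deriv \<phi>)" for S
    by (simp add: continuous_at_imp_continuous_on)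
  have \<phi>: "(LINT s:{0..t}|lebesgue. deriv \<phi> s) = \<phi> t" if "t \<in> {0..T}" for t
    using set_lebesgue_integral_FTC[of 0 t \<phi> "deriv \<phi>"] D cont that zero[of 0] by simp
  have "(LINT t:{0..T}|lebesgue. deriv \<phi> t *\<^sub>R (LINT s:{0..t}|lebesgue. g s)) +
      (LINT t:{0..T}|lebesgue. (LINT s:{0..t}|lebesgue. deriv \<phi> s) *\<^sub>R g t) = 0"
    using set_lebesgue_integral_by_parts[OF bounded_bilinear_scaleR
        set_integrable_continuous_lebesgue[OF cont] g] \<phi>[of T] T zero[of T] by simp
  moreover have "(LINT t:{0..T}|lebesgue. deriv \<phi> t *\<^sub>R (LINT s:{0..t}|lebesgue. g s)) =
      (LINT t:{0..T}|lebesgue. deriv \<phi> t *\<^sub>R u t)"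
    by (intro set_lebesgue_integral_cong) (auto simp: u)
  moreover have "(LINT t:{0..T}|lebesgue. (LINT s:{0..t}|lebesgue. deriv \<phi> s) *\<^sub>R g t) =
      (LINT t:{0..T}|lebesgue. \<phi> t *\<^sub>R g t)"
    by (intro set_lebesgue_integral_cong) (auto simp: \<phi>)
  ultimately show "(LINT t:{0..T}|lebesgue. deriv \<phi> t *\<^sub>R u t) = - (LINT t:{0..T}|lebesgue. \<phi> t *\<^sub>R g t)"
    by (simp add: eq_neg_iff_add_eq_0)
qed


section \<open>The Duhamel integral\<close>

definition duhamel ::
    "('u::{real_inner, banach, second_countable_topology} \<Rightarrow>\<^sub>L 'u) \<Rightarrow> (real \<Rightarrow> 'u) \<Rightarrow> real \<Rightarrow> 'u" where
  "duhamel L f t = (LINT s:{0..t}|lebesgue. op_exp ((- (t - s)) *\<^sub>R L) (f s))"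

lemma set_integrable_op_exp:
  fixes L :: "'u::{real_inner, banach, second_countable_topology} \<Rightarrow>\<^sub>L 'u"
  assumes "set_integrable lebesgue {a..b} f"
  shows "set_integrable lebesgue {a..b} (\<lambda>s. op_exp (s *\<^sub>R L) (f s))"
  by (rule set_integrable_blinfun_apply[OF continuous_op_exp assms])

lemma duhamel_eq:
  assumes f: "set_integrable lebesgue {0..T} f" and t: "t \<in> {0..T}"
  shows "duhamel L f t = op_exp ((- t) *\<^sub>R L) (LINT s:{0..t}|lebesgue. op_exp (s *\<^sub>R L) (f s))"
proof -
  have "set_integrable lebesgue {0..t} f" by (rule set_integrable_subset[OF f]) (use t in auto)
  note set_lebesgue_integral_bounded_linear(2)[OF blinfun.bounded_linear_right[of "op_exp ((- t) *\<^sub>R L)"]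
      set_integrable_op_exp[OF this, of L]]
  moreover have "op_exp ((- (t - s)) *\<^sub>R L) y = op_exp ((- t) *\<^sub>R L) (op_exp (s *\<^sub>R L) y)" for s y
    using op_exp_add[of "- t" s L] by simp
  ultimately show ?thesis by (simp add: duhamel_def)
qed

lemma continuous_on_duhamel:
  assumes f: "set_integrable lebesgue {0..T} f"
  shows "continuous_on {0..T} (duhamel L f)"
proof (rule continuous_on_eq)
  show "continuous_on {0..T} (\<lambda>t. op_exp ((- t) *\<^sub>R L) (LINT s:{0..t}|lebesgue. op_exp (s *\<^sub>R L) (f s)))"
    by (intro continuous_intros continuous_on_set_lebesgue_integral set_integrable_op_exp f
        continuous_on_compose2[OF continuous_op_exp[of UNIV]]) auto
qed (simp add: duhamel_eq[OF f])

text \<open>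
  The operator type is not second countable, so operator-valued functions have no Bochner integral
  here; testing against a vector \<open>y\<close> and moving the semigroup onto \<open>y\<close> by self-adjointness
  replaces \<open>e\<^bsup>-sL\<^esup>\<close> by the vector-valued function \<open>e\<^bsup>-sL\<^esup> y\<close>.
\<close>

lemma duhamel_integral_equation:
  assumes L: "self_adjoint L" and f: "set_integrable lebesgue {0..T} f" and t: "t \<in> {0..T}"
  shows "duhamel L f t = (LINT s:{0..t}|lebesgue. f s - L (duhamel L f s))"
proof (subst vector_eq_ldot[symmetric], intro allI)
  fix y
  define q where "q = duhamel L f"
  define U where "U s = op_exp (s *\<^sub>R L)" for s
  define p where "p s = (LINT r:{0..s}|lebesgue. U r (f r))" for s
  have sa: "inner (U s v) w = inner v (U s w)" for s v w
    using self_adjoint_op_exp[OF L, of s] by (simp add: self_adjoint_def U_def)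
  have inv: "U (- s) (U s v) = v" for s v
  proof -
    have "U (- s) o\<^sub>L U s = id_blinfun"
      unfolding U_def op_exp_add[symmetric] by (simp add: op_exp_zero)
    from arg_cong[OF this, of "\<lambda>A. A v"] show ?thesis by simp
  qed
  have sub: "{0..t} \<subseteq> {0..T}" using t by auto
  have ft: "set_integrable lebesgue {0..t} f" by (rule set_integrable_subset[OF f]) (use t in auto)
  have gt: "set_integrable lebesgue {0..t} (\<lambda>s. U s (f s))"
    unfolding U_def by (rule set_integrable_op_exp[OF ft])
  have q: "q s = U (- s) (p s)" if "s \<in> {0..t}" for s
    using duhamel_eq[OF f, of s L] that sub by (auto simp: q_def U_def p_def)
  have Lq: "set_integrable lebesgue {0..t} (\<lambda>s. L (q s))"
    unfolding q_def
    by (intro set_integrable_continuous_lebesgue continuous_intros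
        continuous_on_subset[OF continuous_on_duhamel[OF f] sub])
  have contU: "continuous_on S (\<lambda>s. U (- s) y)" for S
    unfolding U_def
    by (intro continuous_intros continuous_on_compose2[OF continuous_op_exp[of UNIV]]) auto
  have a: "(LINT r:{0..s}|lebesgue. - L (U (- r) y)) = U (- s) y - y" if "s \<in> {0..t}" for s
  proof -
    have "((\<lambda>s. U (- s) y) has_vector_derivative - L (U (- r) y)) (at r within {0..s})" for r
      using op_exp_has_vector_derivative[of "- L" y r "{0..s}"]
      by (simp add: U_def blinfun.minus_left)
    moreover have "continuous_on {0..s} (\<lambda>r. - L (U (- r) y))"
      by (intro continuous_intros contU)
    ultimately have "(LINT r:{0..s}|lebesgue. - L (U (- r) y)) = U (- s) y - U (- 0) y"
      using that by (intro set_lebesgue_integral_FTC) auto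
    then show ?thesis by (simp add: U_def op_exp_zero)
  qed
  have "continuous_on {0..t} (\<lambda>s. - L (U (- s) y))"
    by (intro continuous_intros contU)
  \<comment> \<open>The primitives are U(-s) y - y and p. Moving U(-s) across the inner product
    turns (- L U(-s) y, p) into - (y, L q) and (U(-s) y, U(s) f) into (y, f); the terms - (y, p(t))
    on the two sides cancel.\<close>
  from set_lebesgue_integral_by_parts[OF bounded_bilinear_inner
      set_integrable_continuous_lebesgue[OF this] gt]
  have "(LINT s:{0..t}|lebesgue. inner (- L (U (- s) y)) (p s)) +
      (LINT s:{0..t}|lebesgue. inner (LINT r:{0..s}|lebesgue. - L (U (- r) y)) (U s (f s))) =
      inner (U (- t) y - y) (p t)"
    using a[of t] t by (simp add: p_def)
  moreover have "(LINT s:{0..t}|lebesgue. inner (- L (U (- s) y)) (p s)) =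
      (LINT s:{0..t}|lebesgue. - inner y (L (q s)))"
  proof (intro set_lebesgue_integral_cong allI impI)
    fix s assume s: "s \<in> {0..t}"
    have "inner (L (U (- s) y)) (p s) = inner y (U (- s) (L (p s)))"
      using L sa by (simp add: self_adjoint_def)
    also have "U (- s) (L (p s)) = L (q s)"
      unfolding q[OF s] U_def by (rule op_exp_commute)
    finally show "inner (- L (U (- s) y)) (p s) = - inner y (L (q s))" by simp
  qed auto
  moreover have "(LINT s:{0..t}|lebesgue. inner (LINT r:{0..s}|lebesgue. - L (U (- r) y)) (U s (f s))) =
      (LINT s:{0..t}|lebesgue. inner y (f s) - inner y (U s (f s)))"
  proof (intro set_lebesgue_integral_cong allI impI)
    fix s assume s: "s \<in> {0..t}"
    show "inner (LINT r:{0..s}|lebesgue. - L (U (- r) y)) (U s (f s)) =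
        inner y (f s) - inner y (U s (f s))"
      by (simp only: a[OF s] inner_diff_left sa inv)
  qed auto
  moreover have "inner (U (- t) y - y) (p t) = inner y (q t) - inner y (p t)"
    using t by (simp add: q inner_diff_left sa)
  moreover note y = set_lebesgue_integral_bounded_linear[OF bounded_linear_inner_right[of y]]
  moreover have "(LINT s:{0..t}|lebesgue. inner y (f s) - inner y (U s (f s))) =
      inner y (LINT s:{0..t}|lebesgue. f s) - inner y (p t)"
    unfolding p_def by (subst set_integral_diff(2)) (simp_all add: y ft gt)
  moreover have "(LINT s:{0..t}|lebesgue. - inner y (L (q s))) =
      - inner y (LINT s:{0..t}|lebesgue. L (q s))"
    by (subst set_integral_uminus) (simp_all add: y Lq)
  moreover have "inner y (LINT s:{0..t}|lebesgue. f s - L (q s)) =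
      inner y (LINT s:{0..t}|lebesgue. f s) - inner y (LINT s:{0..t}|lebesgue. L (q s))"
    by (subst set_integral_diff(2)) (auto intro!: ft Lq simp: inner_diff_right)
  ultimately show "inner y (duhamel L f t) = inner y (LINT s:{0..t}|lebesgue. f s - L (duhamel L f s))"
    unfolding q_def by linarith
qed

lemma duhamel_energy:
  fixes f :: "real \<Rightarrow> 'u::{real_inner, banach, second_countable_topology}"
  assumes T: "0 < T" and L: "self_adjoint L" "nonneg_op L" and f: "set_integrable lebesgue {0..T} f"
  shows "(LINT t:{0..T}|lebesgue. inner (f t) (duhamel L f t)) =
    1 / 2 * (norm (duhamel L f T))\<^sup>2 + (LINT t:{0..T}|lebesgue. (norm (op_sqrt L (duhamel L f t)))\<^sup>2)"
proof -
  let ?q = "duhamel L f"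
  define g where "g t = f t - L (?q t)" for t
  have cont: "continuous_on {0..T} ?q" by (rule continuous_on_duhamel[OF f])
  have Lq: "continuous_on {0..T} (\<lambda>t. L (?q t))" by (intro continuous_intros cont)
  have g: "set_integrable lebesgue {0..T} g"
    unfolding g_def by (intro set_integral_diff f set_integrable_continuous_lebesgue Lq)
  have q: "(LINT s:{0..t}|lebesgue. g s) = ?q t" if "t \<in> {0..T}" for t
    using duhamel_integral_equation[OF L(1) f that] by (simp add: g_def)
  have "(LINT t:{0..T}|lebesgue. inner (g t) (LINT s:{0..t}|lebesgue. g s)) =
      (LINT t:{0..T}|lebesgue. inner (g t) (?q t))"
    by (intro set_lebesgue_integral_cong) (auto simp: q)
  moreover have "(LINT t:{0..T}|lebesgue. inner (LINT s:{0..t}|lebesgue. g s) (g t)) =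
      (LINT t:{0..T}|lebesgue. inner (g t) (?q t))"
    by (intro set_lebesgue_integral_cong) (auto simp: q intro: inner_commute)
  \<comment> \<open>With \<open>g\<close> in both slots the two integrals coincide by symmetry of
    the inner product; this is the origin of the factor 1/2 in the energy.\<close>
  ultimately have "2 * (LINT t:{0..T}|lebesgue. inner (g t) (?q t)) = (norm (?q T))\<^sup>2"
    using set_lebesgue_integral_by_parts[OF bounded_bilinear_inner g g] T q[of T]
    by (simp add: power2_norm_eq_inner)
  moreover have "(LINT t:{0..T}|lebesgue. inner (f t) (?q t)) =
      (LINT t:{0..T}|lebesgue. inner (g t) (?q t) + inner (L (?q t)) (?q t))"
    by (simp add: g_def inner_diff_left)
  moreover have "\<dots> = (LINT t:{0..T}|lebesgue. inner (g t) (?q t)) +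
      (LINT t:{0..T}|lebesgue. inner (L (?q t)) (?q t))"
    by (intro set_integral_add(2) set_integrable_bounded_bilinear[OF bounded_bilinear_inner g cont]
        set_integrable_continuous_lebesgue continuous_on_inner Lq cont)
  ultimately show ?thesis by (simp add: norm_op_sqrt_power2[OF L])
qed

section \<open>The kernel and its quadratic form\<close>

text \<open>The formula for the kernel makes sense for negative t as well, so s \<mapsto> K(t - s)
  is continuous on the whole line, as \<open>set_integrable_blinfun_apply\<close> requires.\<close>

lemma continuous_semigroup_kernel: "continuous_on UNIV (semigroup_kernel L C)"
proof -
  have "continuous_on UNIV (\<lambda>t. op_exp ((- t) *\<^sub>R L))"
    by (intro continuous_on_compose2[OF continuous_op_exp[of UNIV]] continuous_intros) auto
  then show ?thesis
    unfolding semigroup_kernel_def[abs_def]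
    by (intro bounded_bilinear.continuous_on[OF bounded_bilinear_blinfun_compose] continuous_on_const)
qed

lemma kernel_conv_semigroup_kernel:
  fixes L :: "'u::{real_inner, banach, second_countable_topology} \<Rightarrow>\<^sub>L 'u"
  assumes x: "set_integrable lebesgue {0..T} x" and t: "t \<in> {0..T}"
  shows "kernel_conv (semigroup_kernel L C) x t = blinfun_adjoint C (duhamel L (\<lambda>s. C (x s)) t)"
proof -
  have "set_integrable lebesgue {0..t} x" by (rule set_integrable_subset[OF x]) (use t in auto)
  then have "set_integrable lebesgue {0..t} (\<lambda>s. C (x s))"
    by (rule set_lebesgue_integral_bounded_linear(1)[OF blinfun.bounded_linear_right])
  moreover have "continuous_on UNIV (\<lambda>s. op_exp ((- (t - s)) *\<^sub>R L))"
    by (intro continuous_on_compose2[OF continuous_op_exp[of UNIV]] continuous_intros) auto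
  ultimately have "set_integrable lebesgue {0..t} (\<lambda>s. op_exp ((- (t - s)) *\<^sub>R L) (C (x s)))"
    by (rule set_integrable_blinfun_apply[rotated])
  from set_lebesgue_integral_bounded_linear(2)[OF blinfun.bounded_linear_right this, of "blinfun_adjoint C"]
  show ?thesis by (simp add: kernel_conv_def semigroup_kernel_def duhamel_def)
qed

text \<open>The adjoint moves \<open>C\<close> onto \<open>x\<close>, leaving (C x, q). This is
  integrable because \<open>C x\<close> is integrable and \<open>q\<close> is continuous on [0, T],
  hence bounded there.\<close>

lemma quadratic_form_semigroup_kernel:
  fixes L :: "'u::{real_inner, banach, second_countable_topology} \<Rightarrow>\<^sub>L 'u"
    and C :: "'r::{real_inner, banach, second_countable_topology} \<Rightarrow>\<^sub>L 'u"
  assumes T: "0 < T" and L: "self_adjoint L" "nonneg_op L" and x: "set_integrable lebesgue {0..T} x"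
  defines "q \<equiv> duhamel L (\<lambda>s. C (x s))"
  shows "set_integrable lebesgue {0..T} (\<lambda>t. inner (kernel_conv (semigroup_kernel L C) x t) (x t))"
    and "(LINT t:{0..T}|lebesgue. inner (kernel_conv (semigroup_kernel L C) x t) (x t)) =
      1 / 2 * (norm (q T))\<^sup>2 + (LINT t:{0..T}|lebesgue. (norm (op_sqrt L (q t)))\<^sup>2)"
proof -
  have f: "set_integrable lebesgue {0..T} (\<lambda>t. C (x t))"
    by (rule set_lebesgue_integral_bounded_linear(1)[OF blinfun.bounded_linear_right x])
  have eq: "inner (kernel_conv (semigroup_kernel L C) x t) (x t) = inner (C (x t)) (q t)"
    if "t \<in> {0..T}" for t
    using kernel_conv_semigroup_kernel[OF x that, of L C]
    by (simp add: q_def inner_blinfun_adjoint) (rule inner_commute)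
  have "set_integrable lebesgue {0..T} (\<lambda>t. inner (C (x t)) (q t))"
    unfolding q_def
    by (rule set_integrable_bounded_bilinear[OF bounded_bilinear_inner f continuous_on_duhamel[OF f]])
  then show "set_integrable lebesgue {0..T} (\<lambda>t. inner (kernel_conv (semigroup_kernel L C) x t) (x t))"
    by (subst set_integrable_cong[OF refl refl eq])
  have "(LINT t:{0..T}|lebesgue. inner (kernel_conv (semigroup_kernel L C) x t) (x t)) =
      (LINT t:{0..T}|lebesgue. inner (C (x t)) (q t))"
    by (intro set_lebesgue_integral_cong) (auto simp: eq)
  then show "(LINT t:{0..T}|lebesgue. inner (kernel_conv (semigroup_kernel L C) x t) (x t)) =
      1 / 2 * (norm (q T))\<^sup>2 + (LINT t:{0..T}|lebesgue. (norm (op_sqrt L (q t)))\<^sup>2)"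
    unfolding q_def using duhamel_energy[OF T L f] by simp
qed

text \<open>If the integrand is not integrable, its integral is 0 by convention, so the bound covers
  that case too.\<close>

lemma half_norm_plus_energy_nonneg:
  "0 \<le> 1 / 2 * (norm v)\<^sup>2 + (LINT t:S|M. (norm (u t))\<^sup>2)"
  unfolding set_lebesgue_integral_def by (simp add: Bochner_Integration.integral_nonneg)

theorem theorem3p5:
  fixes L :: "'u::{real_inner, banach, second_countable_topology} \<Rightarrow>\<^sub>L 'u"
    and C :: "'r::{real_inner, banach, second_countable_topology} \<Rightarrow>\<^sub>L 'u"
  assumes "self_adjoint L" and "nonneg_op L"
  shows "(\<forall>T>0. \<forall>x. in_L2 T x \<longrightarrow>
           (let q = (\<lambda>t. LINT s:{0..t}|lebesgue. op_exp ((- (t - s)) *\<^sub>R L) (C (x s))) in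
              in_H1 T q \<and> continuous_on {0..T} q \<and>
              (\<exists>q'. in_L2 T q' \<and> has_weak_deriv T q q' \<and>
                 (AE t in lebesgue. t \<in> {0..T} \<longrightarrow> q' t + L (q t) = C (x t))) \<and>
              q 0 = 0 \<and>
              (LINT t:{0..T}|lebesgue. inner (kernel_conv (semigroup_kernel L C) x t) (x t)) =
                1 / 2 * (norm (q T))\<^sup>2 + (LINT t:{0..T}|lebesgue. (norm (op_sqrt L (q t)))\<^sup>2) \<and>
              1 / 2 * (norm (q T))\<^sup>2 + (LINT t:{0..T}|lebesgue. (norm (op_sqrt L (q t)))\<^sup>2) \<ge> 0)) \<and>
         (\<forall>T>0. positive_type_on T (semigroup_kernel L C))"
proof (intro conjI allI impI)
  fix T :: real and x :: "real \<Rightarrow> 'r" assume T: "0 < T" and x: "in_L2 T x"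
  let ?f = "\<lambda>s. C (x s)"
  define q where "q = duhamel L ?f"
  \<comment> \<open>Defined by solving the equation for the derivative, so the equation holds at
    every point; the content is that \<open>q'\<close> is the weak derivative of
    \<open>q\<close>.\<close>
  define q' where "q' t = ?f t - L (q t)" for t
  note ix = in_L2_imp_set_integrable[OF x]
  have f2: "in_L2 T ?f" by (rule in_L2_blinfun[OF x])
  note f = in_L2_imp_set_integrable[OF f2]
  have cont: "continuous_on {0..T} q" unfolding q_def by (rule continuous_on_duhamel[OF f])
  have q': "in_L2 T q'"
    unfolding q'_def
    by (rule in_L2_diff[OF f2 continuous_imp_in_L2]) (intro continuous_intros cont)
  have weak: "has_weak_deriv T q q'"
    by (rule has_weak_deriv_indefinite_integral[OF T in_L2_imp_set_integrable[OF q']])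
      (unfold q_def q'_def, rule duhamel_integral_equation[OF assms(1) f])
  have "AE t in lebesgue. t \<in> {0..T} \<longrightarrow> q' t + L (q t) = C (x t)"
    by (simp add: q'_def)
  \<comment> \<open>The integral runs over the single point 0, a null set.\<close>
  moreover have "q 0 = 0"
    unfolding q_def duhamel_def set_lebesgue_integral_def
    by (rule integral_eq_zero_AE, rule eventually_mono[OF AE_lebesgue_singleton[of 0]])
      (simp add: indicator_def)
  moreover have "1 / 2 * (norm (q T))\<^sup>2 + (LINT t:{0..T}|lebesgue. (norm (op_sqrt L (q t)))\<^sup>2) \<ge> 0"
    by (rule half_norm_plus_energy_nonneg)
  ultimately show "let q = (\<lambda>t. LINT s:{0..t}|lebesgue. op_exp ((- (t - s)) *\<^sub>R L) (C (x s))) in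
      in_H1 T q \<and> continuous_on {0..T} q \<and>
      (\<exists>q'. in_L2 T q' \<and> has_weak_deriv T q q' \<and>
         (AE t in lebesgue. t \<in> {0..T} \<longrightarrow> q' t + L (q t) = C (x t))) \<and>
      q 0 = 0 \<and>
      (LINT t:{0..T}|lebesgue. inner (kernel_conv (semigroup_kernel L C) x t) (x t)) =
        1 / 2 * (norm (q T))\<^sup>2 + (LINT t:{0..T}|lebesgue. (norm (op_sqrt L (q t)))\<^sup>2) \<and>
      1 / 2 * (norm (q T))\<^sup>2 + (LINT t:{0..T}|lebesgue. (norm (op_sqrt L (q t)))\<^sup>2) \<ge> 0"
    using cont q' weak continuous_imp_in_L2[OF cont]
      quadratic_form_semigroup_kernel(2)[OF T assms ix, of C, folded q_def]
    unfolding Let_def duhamel_def[symmetric] q_def[symmetric] in_H1_def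
    by (intro conjI exI[of _ q'])
next
  fix T :: real assume T: "0 < T"
  show "positive_type_on T (semigroup_kernel L C)"
    unfolding positive_type_on_def
  proof (intro allI impI conjI AE_I2)
    fix x :: "real \<Rightarrow> 'r" assume "in_L2 T x"
    then have ix: "set_integrable lebesgue {0..T} x" by (rule in_L2_imp_set_integrable)
    show "set_integrable lebesgue {0..t} (\<lambda>s. semigroup_kernel L C (t - s) (x s))" if "t \<in> {0..T}" for t
    proof (rule set_integrable_blinfun_apply)
      show "continuous_on UNIV (\<lambda>s. semigroup_kernel L C (t - s))"
        by (intro continuous_on_compose2[OF continuous_semigroup_kernel] continuous_intros) auto
      show "set_integrable lebesgue {0..t} x"
        by (rule set_integrable_subset[OF ix]) (use that in auto)
    qed
    note form = quadratic_form_semigroup_kernel[OF T assms ix, of C]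
    show "set_integrable lebesgue {0..T} (\<lambda>t. inner (kernel_conv (semigroup_kernel L C) x t) (x t))"
      by (rule form(1))
    show "0 \<le> (LINT t:{0..T}|lebesgue. inner (kernel_conv (semigroup_kernel L C) x t) (x t))"
      unfolding form(2) by (rule half_norm_plus_energy_nonneg)
  qed
qed

end
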